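(* Let $\phi$ be a pure $t$-module defined over a global function field $K$. Then there is a finite extension $L$ over $K$ such that the base extension of $\phi$ to $L$ satisfies Poonen's Mordell–Weil theorem, that is, the $\mathbb{F}_q[t]$-module $\phi^L(L)$ is the direct sum of its torsion submodule, which is finite, with a free $\mathbb{F}_q[t]$-module of rank $\aleph_0$.
   Context: $\mathbb{F}_q$ is the finite field with $q$ elements, $K$ is a global function field containing $\mathbb{F}_q$, $\theta\in K$ is a fixed element, and $\mathbb{K}$ is an algebraic closure of $K$. For a field $F\supseteq\mathbb{F}_q$, $F\{\tau\}$ is the skew polynomial ring with $\tau\alpha=\alpha^q\tau$ for $\alpha\in F$; $F\{\tau,t\}$ is the skew polynomial ring in $\tau,t$ with in addition $t\alpha=\alpha t$ for $\alpha\in F$, and $t\tau=\tau t$. For $d>0$, a $d$-dimensional (Anderson) $t$-module over a field $F\ni\theta$ is an $\mathbb{F}_q$-algebra homomorphism $\phi:\mathbb{F}_q[t]\to\mathrm{Mat}_d(F\{\tau\})$, $a\mapsto\phi_a$, such that $\partial\phi_t-\theta\mathbb{I}_d$ is nilpotent, where $\partial(\sum_i B_i\tau^i)=B_0$ for $B_i\in\mathrm{Mat}_d(F)$. The base extension $\phi^L$ of $\phi$ to an extension $L$ of $K$ is the composite $\mathbb{F}_q[t]\to\mathrm{Mat}_d(K\{\tau\})\hookrightarrow\mathrm{Mat}_d(L\{\tau\})$. $\phi^L(L)$ denotes the $\mathbb{F}_q[t]$-module with underlying space $L^d$ (column vectors), where $a\in\mathbb{F}_q[t]$ acts through $\phi_a$,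 with $\tau$ acting on $L^d$ by raising all coordinates to the $q$-th power. The associated left $K\{\tau,t\}$-module is $\mathsf{M}_\phi=\mathrm{Mat}_{1\times d}(K\{\tau\})$ with left multiplication by $K\{\tau\}$ and $t\cdot x=x\phi_t$. $\phi$ is abelian if $\mathsf{M}_\phi$ is free of finite rank over $K[t]$. An abelian $\phi$ is pure if there are positive integers $u,v$ and a $\mathbb{K}[\![\frac1t]\!]$-lattice $\tilde\Lambda$ (the $\mathbb{K}[\![\frac1t]\!]$-span of a $\mathbb{K}(\!(\frac1t)\!)$-basis) in $\mathbb{K}(\!(\frac1t)\!)\otimes_{K[t]}\mathsf{M}_\phi$ such that $t^u\tilde\Lambda=\tau^v\tilde\Lambda$, where $\tau(f\otimes m)=f^{(1)}\otimes\tau m$ and $f^{(1)}$ is obtained from $f$ by raising all coefficients to the $q$-th power. *)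

theory Defs
  imports
    "HOL-Algebra.Algebraic_Closure_Type"
    "HOL-Analysis.Finite_Cartesian_Product"
    "HOL-Computational_Algebra.Computational_Algebra"
    "HOL-Library.Poly_Mapping"
begin

hide_const (open) Poly_Mapping.degree Poly_Mapping.range

section \<open>The base field\<close>

definition unital_ring_hom :: "('a::comm_ring_1 \<Rightarrow> 'b::comm_ring_1) \<Rightarrow> bool" where
  "unital_ring_hom h \<longleftrightarrow> h 1 = 1 \<and> (\<forall>x y. h (x + y) = h x + h y) \<and> (\<forall>x y. h (x * y) = h x * h y)"

text \<open>
  A global function field containing \<open>\<bbbF>\<^sub>q\<close> is a finite extension of a rational function field
  \<open>\<bbbF>\<^sub>q(x)\<close>. The finite field is the type \<open>'fq\<close>, so that \<open>q = CARD('fq)\<close> throughout, and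
  \<open>\<iota>\<close> is its inclusion into \<open>K\<close>; \<open>h\<close> is the inclusion of \<open>\<bbbF>\<^sub>q(x)\<close>, where \<open>x\<close> is
  sent to an arbitrary transcendental element of \<open>K\<close>.
\<close>

definition global_function_field :: "('fq::finite_field \<Rightarrow> 'k::field) \<Rightarrow> bool" where
  "global_function_field \<iota> \<longleftrightarrow> unital_ring_hom \<iota> \<and>
     (\<exists>h :: 'fq poly fract \<Rightarrow> 'k. unital_ring_hom h \<and> (\<forall>c. h (Fract [:c:] 1) = \<iota> c) \<and>
        (\<exists>B. finite B \<and> Modules.module.span (\<lambda>c x. h c * x) B = UNIV))"

text \<open>
  Every finite extension of \<open>K\<close> embeds over \<open>K\<close> into the algebraic closure of \<open>K\<close>, so it is no
  restriction to consider subfields of the latter.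
\<close>

definition finite_extension :: "'k::field alg_closure set \<Rightarrow> bool" where
  "finite_extension L \<longleftrightarrow>
     subfield L ring_of_type_algebra \<and> range to_ac \<subseteq> L \<and>
     (\<exists>B. finite B \<and> Modules.module.span (\<lambda>c x. to_ac c * x) B = L)"


section \<open>Skew polynomials\<close>

text \<open>
  An element \<open>\<Sum>\<^sub>i a\<^sub>i \<tau>\<^sup>i\<close> of \<open>F{\<tau>}\<close> is stored as the value \<open>\<Sum>\<^sub>i a\<^sub>i X\<^sup>i\<close> of type \<open>'a poly\<close>. Addition
  is that of \<open>'a poly\<close>, but multiplication is \<open>skew_mult q\<close>, which comes from
  \<open>(a \<tau>\<^sup>i) (b \<tau>\<^sup>j) = a b\<^bsup>q^i\<^esup> \<tau>\<^bsup>i+j\<^esup>\<close>.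
\<close>

definition skew_mult :: "nat \<Rightarrow> 'a::comm_ring_1 poly \<Rightarrow> 'a poly \<Rightarrow> 'a poly" where
  "skew_mult q f g = (\<Sum>i\<le>degree f. \<Sum>j\<le>degree g. monom (coeff f i * coeff g j ^ (q ^ i)) (i + j))"

definition skew_apply :: "nat \<Rightarrow> 'a::comm_ring_1 poly \<Rightarrow> 'a \<Rightarrow> 'a" where
  "skew_apply q f x = (\<Sum>i\<le>degree f. coeff f i * x ^ (q ^ i))"

definition skew_mat_mult ::
    "nat \<Rightarrow> 'a::comm_ring_1 poly ^ 'n::finite ^ 'n \<Rightarrow> 'a poly ^ 'n ^ 'n \<Rightarrow> 'a poly ^ 'n ^ 'n" where
  "skew_mat_mult q A B = (\<chi> i j. \<Sum>k\<in>UNIV. skew_mult q (A $ i $ k) (B $ k $ j))"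

definition skew_row_mult ::
    "nat \<Rightarrow> 'a::comm_ring_1 poly ^ 'n::finite \<Rightarrow> 'a poly ^ 'n ^ 'n \<Rightarrow> 'a poly ^ 'n" where
  "skew_row_mult q m A = (\<chi> j. \<Sum>i\<in>UNIV. skew_mult q (m $ i) (A $ i $ j))"

definition skew_left_mult :: "nat \<Rightarrow> 'a::comm_ring_1 poly \<Rightarrow> 'a poly ^ 'n::finite \<Rightarrow> 'a poly ^ 'n" where
  "skew_left_mult q f m = (\<chi> j. skew_mult q f (m $ j))"


section \<open>t-modules\<close>

definition derivation_part :: "'a::comm_ring_1 poly ^ 'n::finite ^ 'n \<Rightarrow> 'a ^ 'n ^ 'n" where
  "derivation_part A = (\<chi> i j. coeff (A $ i $ j) 0)"

definition nilpotent_matrix :: "'a::comm_ring_1 ^ 'n::finite ^ 'n \<Rightarrow> bool" where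
  "nilpotent_matrix N \<longleftrightarrow> (\<exists>k. (((**) N) ^^ k) (mat 1) = 0)"

text \<open>The dimension \<open>d > 0\<close> is \<open>CARD('n)\<close>, and \<open>[:0, 1:]\<close> is \<open>t \<in> \<bbbF>\<^sub>q[t]\<close>.\<close>

definition t_module ::
    "('fq::finite_field \<Rightarrow> 'k::field) \<Rightarrow> 'k \<Rightarrow> ('fq poly \<Rightarrow> 'k poly ^ 'n::finite ^ 'n) \<Rightarrow> bool" where
  "t_module \<iota> \<theta> \<phi> \<longleftrightarrow>
     (\<forall>a b. \<phi> (a + b) = \<phi> a + \<phi> b) \<and>
     (\<forall>a b. \<phi> (a * b) = skew_mat_mult CARD('fq) (\<phi> a) (\<phi> b)) \<and>
     (\<forall>c. \<phi> [:c:] = mat [:\<iota> c:]) \<and>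
     nilpotent_matrix (derivation_part (\<phi> [:0, 1:]) - mat \<theta>)"

definition base_extension ::
    "('fq::finite_field poly \<Rightarrow> 'k::field poly ^ 'n::finite ^ 'n)
       \<Rightarrow> 'fq poly \<Rightarrow> 'k alg_closure poly ^ 'n ^ 'n" where
  "base_extension \<phi> a = (\<chi> i j. map_poly to_ac (\<phi> a $ i $ j))"

definition t_action ::
    "('fq::finite_field poly \<Rightarrow> 'a::field poly ^ 'n::finite ^ 'n) \<Rightarrow> 'fq poly \<Rightarrow> 'a ^ 'n \<Rightarrow> 'a ^ 'n" where
  "t_action \<phi> a x = (\<chi> i. \<Sum>j\<in>UNIV. skew_apply CARD('fq) (\<phi> a $ i $ j) (x $ j))"


section \<open>The associated motive\<close>

text \<open>
  The motive is \<open>Mat\<^bsub>1\<times>d\<^esub>(K{\<tau>})\<close>, with \<open>t\<close> acting by right multiplication with \<open>\<phi>\<^sub>t\<close>. The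
  polynomial \<open>f\<close> below is an element of the commutative ring \<open>K[t]\<close>.
\<close>

definition motive_scale ::
    "('fq::finite_field poly \<Rightarrow> 'k::field poly ^ 'n::finite ^ 'n)
       \<Rightarrow> 'k poly \<Rightarrow> 'k poly ^ 'n \<Rightarrow> 'k poly ^ 'n" where
  "motive_scale \<phi> f m =
     (\<Sum>i\<le>degree f. skew_left_mult CARD('fq) [:coeff f i:]
        (((\<lambda>x. skew_row_mult CARD('fq) x (\<phi> [:0, 1:])) ^^ i) m))"

definition abelian_t_module :: "('fq::finite_field poly \<Rightarrow> 'k::field poly ^ 'n::finite ^ 'n) \<Rightarrow> bool" where
  "abelian_t_module \<phi> \<longleftrightarrow>
     (\<exists>B. finite B \<and> \<not> Modules.module.dependent (motive_scale \<phi>) B \<and>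
          Modules.module.span (motive_scale \<phi>) B = UNIV)"


section \<open>Extension of scalars\<close>

text \<open>
  For a ring homomorphism \<open>h\<close> from \<open>A\<close> to \<open>B\<close> and an \<open>A\<close>-module \<open>M\<close> with the given scalar
  multiplication, \<open>B \<otimes>\<^sub>A M\<close> is the quotient of the free abelian group on \<open>B \<times> M\<close> by the
  subgroup generated by the usual relations. Its elements are the cosets \<open>tensor_class h smul x\<close>;
  the coset of \<open>frag_of (b, m)\<close> is \<open>b \<otimes> m\<close>.
\<close>

type_synonym ('b, 'm) formal_sum = "('b \<times> 'm) \<Rightarrow>\<^sub>0 int"

definition tensor_relations ::
    "('a \<Rightarrow> 'b::comm_ring_1) \<Rightarrow> ('a \<Rightarrow> 'm::ab_group_add \<Rightarrow> 'm) \<Rightarrow> ('b, 'm) formal_sum set" where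
  "tensor_relations h smul =
     {frag_of (b + b', m) - frag_of (b, m) - frag_of (b', m) | b b' m. True} \<union>
     {frag_of (b, m + m') - frag_of (b, m) - frag_of (b, m') | b m m'. True} \<union>
     {frag_of (b * h a, m) - frag_of (b, smul a m) | a b m. True}"

definition tensor_class ::
    "('a \<Rightarrow> 'b::comm_ring_1) \<Rightarrow> ('a \<Rightarrow> 'm::ab_group_add \<Rightarrow> 'm)
       \<Rightarrow> ('b, 'm) formal_sum \<Rightarrow> ('b, 'm) formal_sum set" where
  "tensor_class h smul x =
     {y. y - x \<in> Modules.module.span frag_cmul (tensor_relations h smul)}"

definition formal_scale :: "'b::comm_ring_1 \<Rightarrow> ('b, 'm) formal_sum \<Rightarrow> ('b, 'm) formal_sum" where
  "formal_scale c = frag_extend (\<lambda>(b, m). frag_of (c * b, m))"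


section \<open>Purity\<close>

text \<open>
  \<open>\<bbbK>((1/t))\<close> is the type \<open>'k alg_closure fls\<close>, whose variable \<open>fls_X\<close> stands for \<open>1/t\<close>. So
  \<open>t\<close> is \<open>fls_X_inv\<close>, and \<open>\<bbbK>[[1/t]]\<close> is \<open>range fps_to_fls\<close>.
\<close>

definition laurent_of_poly :: "'k::field poly \<Rightarrow> 'k alg_closure fls" where
  "laurent_of_poly f = poly (map_poly (\<lambda>c. fls_const (to_ac c)) f) fls_X_inv"

definition laurent_twist :: "nat \<Rightarrow> 'a::field fls \<Rightarrow> 'a fls" where
  "laurent_twist q f = Abs_fls (\<lambda>n. fls_nth f n ^ q)"

definition laurent_class ::
    "('fq::finite_field poly \<Rightarrow> 'k::field poly ^ 'n::finite ^ 'n)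
       \<Rightarrow> ('k alg_closure fls, 'k poly ^ 'n) formal_sum
       \<Rightarrow> ('k alg_closure fls, 'k poly ^ 'n) formal_sum set" where
  "laurent_class \<phi> = tensor_class laurent_of_poly (motive_scale \<phi>)"

definition laurent_basis ::
    "('fq::finite_field poly \<Rightarrow> 'k::field poly ^ 'n::finite ^ 'n)
       \<Rightarrow> nat \<Rightarrow> (nat \<Rightarrow> ('k alg_closure fls, 'k poly ^ 'n) formal_sum) \<Rightarrow> bool" where
  "laurent_basis \<phi> r v \<longleftrightarrow>
     (\<forall>x. \<exists>c. laurent_class \<phi> x = laurent_class \<phi> (\<Sum>i<r. formal_scale (c i) (v i))) \<and>
     (\<forall>c. laurent_class \<phi> (\<Sum>i<r. formal_scale (c i) (v i)) = laurent_class \<phi> 0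
            \<longrightarrow> (\<forall>i<r. c i = 0))"

definition laurent_lattice ::
    "('fq::finite_field poly \<Rightarrow> 'k::field poly ^ 'n::finite ^ 'n)
       \<Rightarrow> ('k alg_closure fls, 'k poly ^ 'n) formal_sum set set \<Rightarrow> bool" where
  "laurent_lattice \<phi> \<Lambda> \<longleftrightarrow>
     (\<exists>r v. laurent_basis \<phi> r v \<and>
        \<Lambda> = {laurent_class \<phi> (\<Sum>i<r. formal_scale (c i) (v i)) | c.
               \<forall>i<r. c i \<in> range fps_to_fls})"

text \<open>
  A map \<open>g\<close> on formal sums that respects the relations induces a map on the tensor product. The
  action of \<open>\<tau>\<close> and multiplication by an element of \<open>\<bbbK>((1/t))\<close> are obtained in this way.
\<close>

definition laurent_induced ::
    "('fq::finite_field poly \<Rightarrow> 'k::field poly ^ 'n::finite ^ 'n)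
       \<Rightarrow> (('k alg_closure fls, 'k poly ^ 'n) formal_sum \<Rightarrow> ('k alg_closure fls, 'k poly ^ 'n) formal_sum)
       \<Rightarrow> ('k alg_closure fls, 'k poly ^ 'n) formal_sum set
       \<Rightarrow> ('k alg_closure fls, 'k poly ^ 'n) formal_sum set" where
  "laurent_induced \<phi> g S = (\<Union>x\<in>S. laurent_class \<phi> (g x))"

definition formal_tau ::
    "nat \<Rightarrow> ('k::field alg_closure fls, 'k poly ^ 'n::finite) formal_sum
       \<Rightarrow> ('k alg_closure fls, 'k poly ^ 'n) formal_sum" where
  "formal_tau q = frag_extend (\<lambda>(f, m). frag_of (laurent_twist q f, skew_left_mult q [:0, 1:] m))"

definition pure_t_module :: "('fq::finite_field poly \<Rightarrow> 'k::field poly ^ 'n::finite ^ 'n) \<Rightarrow> bool" where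
  "pure_t_module \<phi> \<longleftrightarrow> abelian_t_module \<phi> \<and>
     (\<exists>u v \<Lambda>. 0 < u \<and> 0 < v \<and> laurent_lattice \<phi> \<Lambda> \<and>
        laurent_induced \<phi> (formal_scale (fls_X_inv ^ u)) ` \<Lambda> =
        (laurent_induced \<phi> (formal_tau CARD('fq)) ^^ v) ` \<Lambda>)"


section \<open>Poonen's Mordell--Weil property\<close>

definition points :: "'a set \<Rightarrow> ('a ^ 'n::finite) set" where
  "points L = {x. \<forall>i. x $ i \<in> L}"

definition torsion :: "('r::comm_ring_1 \<Rightarrow> 'm::ab_group_add \<Rightarrow> 'm) \<Rightarrow> 'm set \<Rightarrow> 'm set" where
  "torsion smul V = {x \<in> V. \<exists>a. a \<noteq> 0 \<and> smul a x = 0}"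

text \<open>
  \<open>V\<close> is a submodule of the module given by \<open>smul\<close>. A basis of cardinality \<open>\<aleph>\<^sub>0\<close> is one that is
  countable and infinite.
\<close>

definition poonen_mordell_weil ::
    "('r::comm_ring_1 \<Rightarrow> 'm::ab_group_add \<Rightarrow> 'm) \<Rightarrow> 'm set \<Rightarrow> bool" where
  "poonen_mordell_weil smul V \<longleftrightarrow>
     finite (torsion smul V) \<and>
     (\<exists>F. Modules.module.subspace smul F \<and>
        V = {x + y | x y. x \<in> torsion smul V \<and> y \<in> F} \<and> torsion smul V \<inter> F = {0} \<and>
        (\<exists>B. countable B \<and> infinite B \<and> \<not> Modules.module.dependent smul B \<and>
             Modules.module.span smul B = F))"

end

theory Submission
  imports Defs
begin

text \<open>
  The theorem holds with \<open>L = K\<close>. The proof is a Mordell--Weil descent for the \<open>\<bbbF>\<^sub>q[t]\<close>-module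
  \<open>V = K\<^sup>d\<close>: there is a height \<open>H\<close> on \<open>V\<close> with finitely many points
  below each bound, with \<open>H (x - y) \<le> H x + H y\<close>, and with \<open>2 H x \<le> H (t\<^sup>D x) + c\<close> for some \<open>D\<close>.

  \<^bold>\<open>The height.\<close> An element \<open>m\<close> of the motive is a functional \<open>V \<rightarrow> K\<close>, for which \<open>(\<tau> m)(x) = m(x)\<^sup>q\<close>
  and \<open>(t m)(x) = m(\<phi>\<^sub>t x)\<close>. Let \<open>b\<^sub>1, \<dots>, b\<^sub>r\<close> generate the motive over \<open>K[t]\<close>. Expressing
  \<open>\<tau>\<^sup>2 b\<^sub>j\<close> in these generators, with coefficients of degree less than \<open>D\<close> in \<open>t\<close>, shows
  that the \<open>q\<^sup>2\<close>-th powers of the entries of the tuple \<open>y(x) = (b\<^sub>j (t\<^sup>k x))\<close>, \<open>k < D\<close>, are fixed linear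
  combinations of the entries of \<open>y(x)\<close> and \<open>y(t\<^sup>D x)\<close>. A \<open>q\<^sup>2\<close>-th power has \<open>q\<^sup>2 \<ge> 4\<close> times the height, so \<open>4 H x \<le> H x + H (t\<^sup>D x) + c\<close> for the
  height \<open>H x\<close> of \<open>y(x)\<close>. The coordinates of \<open>x\<close> are linear combinations of \<open>y(x)\<close> as well, which gives
  finiteness (lemma \<open>t_module_height\<close>).

  Heights on \<open>K\<close> are reduced to heights of tuples over \<open>\<bbbF>\<^sub>q(x)\<close>, that is, to the degree of a reduced
  common denominator and the numerators, by taking coordinates. If \<open>K\<close> is inseparable over \<open>\<bbbF>\<^sub>q(x)\<close>,
  a high Frobenius power is applied first; the coordinates of the result are compatible with Frobenius
  (lemma \<open>frobenius_coordinates\<close>).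

  \<^bold>\<open>The descent.\<close> Torsion points have height at most \<open>c\<close>, so they are finitely many. If \<open>W\<close> is a finitely
  generated submodule with torsion-free \<open>V/W\<close>, and \<open>N/W\<close> is the set of elements of \<open>V/W\<close> that are
  dependent on a given \<open>v \<notin> W\<close>, then \<open>N/W\<close> has rank one, \<open>N\<close> is spanned by \<open>W\<close>, \<open>tN\<close> and at most one more
  element, and descent makes \<open>N\<close> finitely generated. Hence \<open>N/W\<close> is cyclic and a generator of it
  continues a basis (lemma \<open>saturated_extension\<close>). Starting from the torsion and exhausting the countable
  set \<open>V\<close>, this produces the basis of a free complement of the torsion.

  \<^bold>\<open>Infinite rank.\<close> The process never stops, since \<open>V\<close> is not finitely generated: otherwise
  \<open>V/t\<^sup>DV\<close> would be finite, and doubling a height bound would multiply the number of points by a constant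
  at most, whereas the number of points of \<open>V\<close> grows exponentially with the height bound
  (lemma \<open>not_finitely_generated\<close>).
\<close>

section \<open>Polynomials over a field\<close>

lemma poly_ideal_generator:
  fixes I :: "'a::field poly set"
  assumes "a \<in> I" "a \<noteq> 0"
    and add: "\<And>x y. x \<in> I \<Longrightarrow> y \<in> I \<Longrightarrow> x + y \<in> I"
    and mult: "\<And>r x. x \<in> I \<Longrightarrow> r * x \<in> I"
  obtains g where "g \<in> I" "g \<noteq> 0" "\<And>x. x \<in> I \<Longrightarrow> g dvd x"
proof -
  define P where "P = (\<lambda>g. g \<in> I \<and> g \<noteq> 0)"
  obtain g where g: "P g" and min: "\<And>g'. P g' \<Longrightarrow> degree g \<le> degree g'"
    using arg_min_nat_lemma[of P a degree] assms(1,2) unfolding P_def by blast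
  have "g dvd x" if "x \<in> I" for x
  proof -
    have "x mod g = x + (- (x div g)) * g"
      by (simp add: minus_div_mult_eq_mod[symmetric])
    then have "x mod g \<in> I"
      using add[OF that mult] g unfolding P_def by metis
    then have "x mod g = 0"
      using min[of "x mod g"] degree_mod_less[of g x] g unfolding P_def by fastforce
    then show ?thesis by auto
  qed
  with g that show thesis unfolding P_def by blast
qed

lemma poly_bezout:
  fixes a b :: "'a::field poly"
  assumes "a \<noteq> 0 \<or> b \<noteq> 0"
  obtains g u v a' b' where "g \<noteq> 0" "a = g * a'" "b = g * b'" "u * a' + v * b' = 1"
proof -
  define I where "I = {u * a + v * b | u v. True}"
  have ab: "a \<in> I" "b \<in> I"
    unfolding I_def using mult_1 add_0 add_0_right mult_zero_left by (smt (verit) mem_Collect_eq)+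
  obtain c where c: "c \<in> I" "c \<noteq> 0" using ab assms by blast
  have add: "x + y \<in> I" if xy: "x \<in> I" "y \<in> I" for x y
  proof -
    obtain u v where "x = u * a + v * b" using xy(1) unfolding I_def by blast
    moreover obtain u' v' where "y = u' * a + v' * b" using xy(2) unfolding I_def by blast
    ultimately have "x + y = (u + u') * a + (v + v') * b" by (simp add: algebra_simps)
    then show ?thesis unfolding I_def by blast
  qed
  have mult: "r * x \<in> I" if x: "x \<in> I" for r x
  proof -
    obtain u v where "x = u * a + v * b" using x unfolding I_def by blast
    then have "r * x = (r * u) * a + (r * v) * b" by (simp add: algebra_simps)
    then show ?thesis unfolding I_def by blast
  qed
  obtain g where g: "g \<in> I" "g \<noteq> 0" "\<And>x. x \<in> I \<Longrightarrow> g dvd x"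
    using poly_ideal_generator[OF c add mult] by blast
  obtain u v where uv: "g = u * a + v * b" using g unfolding I_def by blast
  obtain a' b' where ab': "a = g * a'" "b = g * b'" using g(3) ab by (meson dvdE)
  have "g * (u * a' + v * b') = g * 1" using uv ab' by (simp add: algebra_simps)
  then have "u * a' + v * b' = 1" using g(2) mult_left_cancel by blast
  then show thesis using that ab' g(2) by blast
qed

lemma finite_poly_degree_le: "finite {p :: 'f::{finite,zero} poly. degree p \<le> n}"
proof -
  have "{p :: 'f poly. degree p \<le> n} \<subseteq> Poly ` {xs. set xs \<subseteq> UNIV \<and> length xs \<le> Suc n}"
  proof
    fix p :: "'f poly" assume "p \<in> {p. degree p \<le> n}"
    then have "length (coeffs p) \<le> Suc n"
      by (metis (mono_tags) Suc_le_mono le0 length_0_conv length_coeffs_degree mem_Collect_eq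
          coeffs_eq_Nil)
    then show "p \<in> Poly ` {xs. set xs \<subseteq> UNIV \<and> length xs \<le> Suc n}"
      by (metis (mono_tags, lifting) Poly_coeffs image_eqI mem_Collect_eq subset_UNIV)
  qed
  then show ?thesis
    by (rule finite_subset) (intro finite_imageI finite_lists_length_le finite)
qed

text \<open>
  The sums of sets of monomials already suffice for the count.
\<close>

lemma card_poly_degree_le: "2 ^ n \<le> card {p :: 'f::finite_field poly. degree p \<le> n}"
proof -
  define f :: "nat set \<Rightarrow> 'f poly" where "f S = (\<Sum>i\<in>S. monom 1 i)" for S
  have cf: "coeff (f S) j = (if j \<in> S then 1 else 0)" if "S \<subseteq> {..<n}" for S j
    using finite_subset[OF that] by (auto simp: f_def coeff_sum)
  have "inj_on f (Pow {..<n})"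
    by (rule inj_onI) (metis PowD cf one_neq_zero subsetI subset_antisym)
  then have "card (f ` Pow {..<n}) = 2 ^ n"
    by (simp add: card_image card_Pow)
  moreover have "f ` Pow {..<n} \<subseteq> {p. degree p \<le> n}"
    by (fastforce intro!: degree_le simp: cf)
  ultimately show ?thesis
    by (metis card_mono finite_poly_degree_le)
qed

lemma exists_power_two_ge_linear: "\<exists>j::nat. a * j + b \<le> (2::nat) ^ j"
proof -
  have sq: "n * n \<le> 4 * 2 ^ n" for n :: nat
  proof (induction n rule: less_induct)
    case (less n)
    show ?case
    proof (cases "n < 4")
      case True
      then have "n = 0 \<or> n = 1 \<or> n = 2 \<or> n = 3" by linarith
      then show ?thesis by auto
    next
      case False
      then obtain m where m: "n = Suc m" "3 \<le> m" by (cases n) auto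
      have "3 * m \<le> m * m" using m(2) by simp
      have "Suc (2 * m) \<le> 3 * m" using m(2) by simp
      also have "\<dots> \<le> m * m" by fact
      finally have "Suc m * Suc m \<le> 2 * (m * m)" by simp
      also have "\<dots> \<le> 2 * (4 * 2 ^ m)" using less[of m] m(1) by simp
      finally show ?thesis by (simp add: m(1))
    qed
  qed
  define j where "j = 4 * (a + b) + 1"
  have "4 * (a * j + b) \<le> (4 * (a + b)) * j"
    by (simp add: algebra_simps j_def)
  also have "\<dots> \<le> j * j" by (simp add: j_def)
  also have "\<dots> \<le> 4 * 2 ^ j" by (rule sq)
  finally have "a * j + b \<le> 2 ^ j" by simp
  then show ?thesis ..
qed

section \<open>Descent in modules with a height\<close>

text \<open>
  The expansion constant 2 can be any number greater than 1: the descent only needs that a point of large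
  height which is congruent to a given one modulo \<open>t\<^sup>d\<close> can be replaced by a point of smaller height.
\<close>

locale height_module = Modules.module smul
  for smul :: "'f::finite_field poly \<Rightarrow> 'm::ab_group_add \<Rightarrow> 'm" +
  fixes V :: "'m set" and H :: "'m \<Rightarrow> nat" and d c :: nat
  assumes subspace_V: "subspace V"
    and height_diff: "\<And>x y. x \<in> V \<Longrightarrow> y \<in> V \<Longrightarrow> H (x - y) \<le> H x + H y"
    and northcott: "\<And>n. finite {x \<in> V. H x \<le> n}"
    and expanding: "\<And>x. x \<in> V \<Longrightarrow> 2 * H x \<le> H (smul (monom 1 d) x) + c"
begin

text \<open>
  Equivalently, \<open>V/W\<close> is torsion-free.
\<close>

definition saturated :: "'m set \<Rightarrow> bool" where
  "saturated W \<longleftrightarrow> subspace W \<and> W \<subseteq> V \<and> (\<forall>x\<in>V. \<forall>a. a \<noteq> 0 \<longrightarrow> smul a x \<in> W \<longrightarrow> x \<in> W)"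

text \<open>
  The orbit of a torsion point under \<open>\<bbbF>\<^sub>q[t]\<close> is finite, and a point of maximal height in it cannot
  have its height increased by \<open>t\<^sup>d\<close>.
\<close>

lemma torsion_bounded:
  assumes "x \<in> torsion smul V"
  shows "H x \<le> c"
proof -
  obtain a where a: "a \<noteq> 0" "smul a x = 0" and x: "x \<in> V"
    using assms unfolding torsion_def by blast
  define orb where "orb = range (\<lambda>b. smul b x)"
  have red: "smul b x = smul (b mod a) x" for b
  proof -
    have "smul b x = smul (b div a * a + b mod a) x" by simp
    also have "\<dots> = smul (b div a) (smul a x) + smul (b mod a) x"
      by (simp only: scale_left_distrib scale_scale)
    finally show ?thesis using a by simp
  qed
  have "degree (b mod a) \<le> degree a" for b
    using degree_mod_less[OF a(1), of b] by auto
  then have "orb \<subseteq> (\<lambda>b. smul b x) ` {p. degree p \<le> degree a}"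
    unfolding orb_def using red by blast
  then have "finite orb" using finite_poly_degree_le finite_surj by blast
  moreover have "x \<in> orb" unfolding orb_def by (metis rangeI scale_one)
  ultimately have "Max (H ` orb) \<in> H ` orb" by (intro Max_in) auto
  then obtain y where y: "y \<in> orb" "H y = Max (H ` orb)" by (metis imageE)
  have max: "H z \<le> H y" if "z \<in> orb" for z
    unfolding y(2) using \<open>finite orb\<close> that by simp
  have "smul (monom 1 d) y \<in> orb" "y \<in> V"
    using y(1) x subspace_scale[OF subspace_V] unfolding orb_def by auto
  then have "H y \<le> c" using expanding[of y] max[of "smul (monom 1 d) y"] by simp
  then show ?thesis using max[OF \<open>x \<in> orb\<close>] by simp
qed

lemma finite_torsion: "finite (torsion smul V)"
  by (rule finite_subset[OF _ northcott[of c]]) (auto simp: torsion_bounded, auto simp: torsion_def)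

lemma saturated_torsion: "saturated (torsion smul V)"
proof -
  have "x + y \<in> torsion smul V" if xy: "x \<in> torsion smul V" "y \<in> torsion smul V" for x y
  proof -
    obtain a b where "a \<noteq> 0" "b \<noteq> 0" "smul a x = 0" "smul b y = 0" "x \<in> V" "y \<in> V"
      using xy unfolding torsion_def by blast
    moreover have "smul (a * b) (x + y) = smul b (smul a x) + smul a (smul b y)"
      by (simp add: scale_right_distrib mult.commute)
    ultimately have "smul (a * b) (x + y) = 0" "a * b \<noteq> 0" "x + y \<in> V"
      using subspace_add[OF subspace_V] by auto
    then show ?thesis unfolding torsion_def by blast
  qed
  moreover have "smul b x \<in> torsion smul V" if x: "x \<in> torsion smul V" for x b
  proof -
    obtain a where a: "a \<noteq> 0" "smul a x = 0" "x \<in> V" using x unfolding torsion_def by blast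
    have "smul a (smul b x) = smul b (smul a x)" by (simp add: mult.commute)
    then have "smul a (smul b x) = 0" "smul b x \<in> V"
      using a subspace_scale[OF subspace_V] by auto
    then show ?thesis using a(1) unfolding torsion_def by blast
  qed
  moreover have "0 \<in> torsion smul V"
    unfolding torsion_def using subspace_0[OF subspace_V] by (auto intro: exI[of _ 1])
  moreover have "x \<in> torsion smul V" if x: "x \<in> V" "a \<noteq> 0" "smul a x \<in> torsion smul V" for x a
  proof -
    obtain b where "b \<noteq> 0" "smul b (smul a x) = 0" using x(3) unfolding torsion_def by blast
    then have "b * a \<noteq> 0" "smul (b * a) x = 0" using x(2) by auto
    then show ?thesis using x(1) unfolding torsion_def by blast
  qed
  moreover have "torsion smul V \<subseteq> V" by (auto simp: torsion_def)
  ultimately show ?thesis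
    unfolding saturated_def subspace_def by blast
qed

text \<open>
  Dividing the coefficients of a combination of \<open>G\<close> by \<open>t\<^sup>d\<close> leaves finitely many remainders, because the
  coefficient field is finite.
\<close>

lemma finite_residues:
  assumes N: "subspace N" and G: "finite G" "G \<subseteq> N"
    and gen: "\<And>x. x \<in> N \<Longrightarrow> \<exists>g\<in>span G. \<exists>y\<in>N. x = g + smul (monom 1 d) y"
  obtains R where "finite R" "R \<subseteq> N" "\<And>x. x \<in> N \<Longrightarrow> \<exists>r\<in>R. \<exists>y\<in>N. x = r + smul (monom 1 d) y"
proof -
  define P where "P = {p :: 'f poly. degree p \<le> d}"
  define R where "R = (\<lambda>r. \<Sum>g\<in>G. smul (r g) g) ` (PiE G (\<lambda>_. P))"
  have "finite R"
    unfolding R_def P_def by (intro finite_imageI finite_PiE G finite_poly_degree_le)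
  moreover have "R \<subseteq> N"
    unfolding R_def using G by (auto intro!: subspace_sum[OF N] subspace_scale[OF N])
  moreover have "\<exists>r\<in>R. \<exists>y\<in>N. x = r + smul (monom 1 d) y" if x: "x \<in> N" for x
  proof -
    let ?T = "monom 1 d :: 'f poly"
    obtain g y where gy: "g \<in> span G" "y \<in> N" "x = g + smul ?T y" using gen[OF x] by blast
    obtain u where u: "g = (\<Sum>v\<in>G. smul (u v) v)" using gy(1) span_finite[OF G(1)] by auto
    define r where "r = restrict (\<lambda>v. u v mod ?T) G"
    define z where "z = (\<Sum>v\<in>G. smul (u v div ?T) v)"
    have "smul (u v) v = smul (r v) v + smul ?T (smul (u v div ?T) v)" if "v \<in> G" for v
    proof -
      have "u v = r v + ?T * (u v div ?T)" using that by (simp add: r_def)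
      then show ?thesis by (metis scale_left_distrib scale_scale)
    qed
    then have "g = (\<Sum>v\<in>G. smul (r v) v) + smul ?T z"
      unfolding u z_def by (simp add: scale_sum_right sum.distrib del: scale_scale)
    moreover have "r \<in> PiE G (\<lambda>_. P)"
    proof -
      have "degree (u v mod ?T) \<le> d" for v
        using degree_mod_less[of ?T "u v"] by (auto simp: degree_monom_eq)
      then show ?thesis by (auto simp: r_def P_def)
    qed
    moreover have "z \<in> N"
      unfolding z_def using G by (auto intro!: subspace_sum[OF N] subspace_scale[OF N])
    ultimately have "(\<Sum>v\<in>G. smul (r v) v) \<in> R" "z + y \<in> N"
        "x = (\<Sum>v\<in>G. smul (r v) v) + smul ?T (z + y)"
      using gy subspace_add[OF N] by (auto simp: R_def scale_right_distrib add.assoc)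
    then show ?thesis by blast
  qed
  ultimately show thesis using that by blast
qed

text \<open>
  Mordell--Weil descent: writing \<open>x = r + t\<^sup>d y\<close>, the height of \<open>y\<close> is at most about half that of \<open>x\<close>, so \<open>N\<close> is
  generated by the representatives and the finitely many points of small height.
\<close>

lemma descent:
  assumes N: "subspace N" "N \<subseteq> V" and R: "finite R" "R \<subseteq> N"
    and gen: "\<And>x. x \<in> N \<Longrightarrow> \<exists>r\<in>R. \<exists>y\<in>N. x = r + smul (monom 1 d) y"
  obtains G where "finite G" "span G = N"
proof -
  obtain h where h: "\<And>r. r \<in> R \<Longrightarrow> H r \<le> h"
    using R(1) by (meson finite_imageI finite_nat_set_iff_bounded_le imageI)
  define G where "G = R \<union> {x \<in> N. H x \<le> h + c}"
  have "finite {x \<in> N. H x \<le> h + c}"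
    by (rule finite_subset[OF _ northcott[of "h + c"]]) (use N in auto)
  then have fin: "finite G" using R by (simp add: G_def)
  have GN: "G \<subseteq> N" using R by (auto simp: G_def)
  have "x \<in> span G" if "x \<in> N" for x
    using that
  proof (induction "H x" arbitrary: x rule: less_induct)
    case less
    show ?case
    proof (cases "H x \<le> h + c")
      case True
      then show ?thesis using less.prems by (auto simp: G_def intro: span_base)
    next
      case False
      obtain r y where ry: "r \<in> R" "y \<in> N" "x = r + smul (monom 1 d) y"
        using gen[OF less.prems] by blast
      have "2 * H y \<le> H (x - r) + c" using expanding[of y] ry N by auto
      also have "\<dots> \<le> H x + h + c"
        using height_diff[of x r] less.prems ry R N h[OF ry(1)] by fastforce
      finally have "H y < H x" using False by simp
      then have "y \<in> span G" using less ry by blast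
      moreover have "r \<in> span G" using ry by (auto simp: G_def intro: span_base)
      ultimately show ?thesis using ry by (auto intro: span_add span_scale)
    qed
  qed
  then show thesis using that[OF fin] span_minimal[OF GN N(1)] by blast
qed

text \<open>
  Iterating \<open>N = \<langle>G\<rangle> + tN\<close> gives \<open>N = \<langle>G\<rangle> + t\<^sup>dN\<close>, to which the descent applies.
\<close>

lemma finitely_generated_if_mod_variable:
  assumes N: "subspace N" "N \<subseteq> V" and G: "finite G" "G \<subseteq> N"
    and gen: "\<And>x. x \<in> N \<Longrightarrow> \<exists>g\<in>span G. \<exists>y\<in>N. x = g + smul (monom 1 1) y"
  obtains G' where "finite G'" "span G' = N"
proof -
  have iter: "\<exists>g\<in>span G. \<exists>y\<in>N. x = g + smul (monom 1 j) y" if "x \<in> N" for x j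
    using that
  proof (induction j arbitrary: x)
    case 0
    then show ?case by (intro bexI[of _ 0] bexI[of _ x]) (simp_all add: span_zero)
  next
    case (Suc j)
    obtain g y where gy: "g \<in> span G" "y \<in> N" "x = g + smul (monom 1 j) y"
      using Suc by blast
    obtain g' y' where gy': "g' \<in> span G" "y' \<in> N" "y = g' + smul (monom 1 1) y'"
      using gen[OF gy(2)] by blast
    have "x = (g + smul (monom 1 j) g') + smul (monom 1 (Suc j)) y'"
      unfolding gy(3) gy'(3) by (simp add: scale_right_distrib mult_monom add.assoc)
    moreover have "g + smul (monom 1 j) g' \<in> span G" using gy gy' by (intro span_add span_scale)
    ultimately show ?case using gy'(2) by blast
  qed
  obtain R where R: "finite R" "R \<subseteq> N" "\<And>x. x \<in> N \<Longrightarrow> \<exists>r\<in>R. \<exists>y\<in>N. x = r + smul (monom 1 d) y"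
    using finite_residues[OF N(1) G iter] by metis
  show thesis by (rule descent[OF N R that])
qed

text \<open>
  Since \<open>W\<close> is saturated, the relation may be divided by the greatest common divisor of its coefficients.
  Completing the resulting coprime pair to a unimodular matrix yields one generator for \<open>x\<close> and \<open>y\<close>
  modulo \<open>W\<close>.
\<close>

lemma merge:
  assumes W: "saturated W" and N: "subspace N" "N \<subseteq> V" "x \<in> N" "y \<in> N"
    and rel: "a \<noteq> 0 \<or> b \<noteq> 0" "smul a x + smul b y \<in> W"
  obtains z r s where "z \<in> N" "x - smul r z \<in> W" "y - smul s z \<in> W"
proof -
  obtain g u v a' b' where g: "g \<noteq> 0" "a = g * a'" "b = g * b'" "u * a' + v * b' = 1"
    using poly_bezout[OF rel(1)] by metis
  define w where "w = smul a' x + smul b' y"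
  have "smul g w \<in> W" using rel(2) by (simp add: w_def g scale_right_distrib)
  moreover have "w \<in> N" unfolding w_def using N by (meson subspace_add subspace_scale)
  ultimately have w: "w \<in> W" using W N g(1) unfolding saturated_def by blast
  have sW: "subspace W" using W unfolding saturated_def by blast
  define z where "z = smul v x - smul u y"
  have "x - smul b' z = smul u w"
  proof -
    have "x = smul (u * a' + v * b') x" using g by simp
    then show ?thesis unfolding z_def w_def
      by (simp add: algebra_simps)
  qed
  moreover have "y - smul (- a') z = smul v w"
  proof -
    have "y = smul (u * a' + v * b') y" using g by simp
    then show ?thesis unfolding z_def w_def
      by (simp add: algebra_simps)
  qed
  moreover have "z \<in> N" unfolding z_def using N by (meson subspace_diff subspace_scale)
  ultimately show thesis using that subspace_scale[OF sW w] by metis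
qed

lemma merge_finite:
  assumes W: "saturated W" and N: "subspace N" "N \<subseteq> V"
    and rel: "\<And>x y. x \<in> N \<Longrightarrow> y \<in> N \<Longrightarrow> \<exists>a b. (a \<noteq> 0 \<or> b \<noteq> 0) \<and> smul a x + smul b y \<in> W"
    and G: "finite G" "G \<subseteq> N"
  shows "\<exists>z\<in>N. \<forall>x\<in>G. \<exists>r. x - smul r z \<in> W"
  using G
proof (induction G rule: finite_induct)
  case empty
  then show ?case using subspace_0[OF N(1)] by blast
next
  case (insert x G)
  then obtain z where z: "z \<in> N" "\<And>y. y \<in> G \<Longrightarrow> \<exists>r. y - smul r z \<in> W" by blast
  have sW: "subspace W" using W unfolding saturated_def by blast
  obtain z' r s where z': "z' \<in> N" "x - smul r z' \<in> W" "z - smul s z' \<in> W"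
    using merge[OF W N, of x z] rel[of x z] insert z by (metis insert_subset)
  have "\<exists>r. y - smul r z' \<in> W" if y: "y \<in> G" for y
  proof -
    obtain k where k: "y - smul k z \<in> W" using z(2)[OF y] by blast
    have "y - smul (k * s) z' = (y - smul k z) + smul k (z - smul s z')"
      by (simp add: algebra_simps)
    then show ?thesis using k z'(3) subspace_add[OF sW] subspace_scale[OF sW] by metis
  qed
  then show ?case using z' by blast
qed

text \<open>
  The new saturated module is \<open>N = {x. a x \<in> W + \<langle>v\<rangle> for some a \<noteq> 0}\<close>, and it is \<open>W + \<langle>b\<rangle>\<close>. The crucial
  point is that \<open>N\<close> is finitely generated, for then the generators can be merged into one.
\<close>

lemma saturated_extension:
  assumes W: "saturated W" "finite G0" "span G0 = W" and v: "v \<in> V" "v \<notin> W"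
  obtains b G where "b \<in> V" "b \<notin> W" "saturated {x. \<exists>k. x - smul k b \<in> W}"
    "v \<in> {x. \<exists>k. x - smul k b \<in> W}" "finite G" "span G = {x. \<exists>k. x - smul k b \<in> W}"
proof -
  have sW: "subspace W" and WV: "W \<subseteq> V"
    and sat: "\<And>x a. x \<in> V \<Longrightarrow> a \<noteq> 0 \<Longrightarrow> smul a x \<in> W \<Longrightarrow> x \<in> W"
    using W unfolding saturated_def by blast+
  define N where "N = {x \<in> V. \<exists>a r. a \<noteq> 0 \<and> smul a x - smul r v \<in> W}"
  have NV: "N \<subseteq> V" by (auto simp: N_def)
  have NI: "x \<in> N" if "x \<in> V" "a \<noteq> 0" "smul a x - smul r v \<in> W" for x a r
    using that unfolding N_def by blast
  have NE: thesis if "x \<in> N" "\<And>a r. x \<in> V \<Longrightarrow> a \<noteq> 0 \<Longrightarrow> smul a x - smul r v \<in> W \<Longrightarrow> thesis" for x thesis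
    using that unfolding N_def by blast
  have WN: "W \<subseteq> N"
  proof
    fix x assume "x \<in> W"
    then show "x \<in> N" using WV by (intro NI[of x 1 0]) auto
  qed
  have vN: "v \<in> N" using v subspace_0[OF sW] by (intro NI[of v 1 1]) auto
  have sN: "subspace N"
    unfolding subspace_def
  proof (intro conjI ballI allI)
    show "0 \<in> N" using WN subspace_0[OF sW] by blast
    fix x assume x: "x \<in> N"
    then obtain a r where a: "x \<in> V" "a \<noteq> 0" "smul a x - smul r v \<in> W" by (rule NE)
    show "smul k x \<in> N" for k
    proof (rule NI)
      show "smul k x \<in> V" using a subspace_scale[OF subspace_V] by blast
      have "smul a (smul k x) - smul (k * r) v = smul k (smul a x - smul r v)"
        by (simp add: algebra_simps)
      then show "smul a (smul k x) - smul (k * r) v \<in> W" using a subspace_scale[OF sW] by metis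
    qed (rule a)
    fix y assume y: "y \<in> N"
    then obtain a' r' where a': "y \<in> V" "a' \<noteq> 0" "smul a' y - smul r' v \<in> W" by (rule NE)
    show "x + y \<in> N"
    proof (rule NI)
      show "x + y \<in> V" using a a' subspace_add[OF subspace_V] by blast
      have "smul (a * a') (x + y) - smul (a' * r + a * r') v
          = smul a' (smul a x - smul r v) + smul a (smul a' y - smul r' v)"
        by (simp add: algebra_simps)
      then show "smul (a * a') (x + y) - smul (a' * r + a * r') v \<in> W"
        using a a' subspace_scale[OF sW] subspace_add[OF sW] by metis
      show "a * a' \<noteq> 0" using a a' by simp
    qed
  qed
  have rel: "\<exists>a b. (a \<noteq> 0 \<or> b \<noteq> 0) \<and> smul a x + smul b y \<in> W" if x: "x \<in> N" and y: "y \<in> N" for x y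
  proof -
    obtain a r where a: "a \<noteq> 0" "smul a x - smul r v \<in> W" using x by (rule NE)
    obtain a' r' where a': "a' \<noteq> 0" "smul a' y - smul r' v \<in> W" using y by (rule NE)
    show ?thesis
    proof (cases "r = 0")
      case True
      then show ?thesis using a by (intro exI[of _ a] exI[of _ 0]) simp
    next
      case False
      have "smul (r' * a) x + smul (- (r * a')) y
          = smul r' (smul a x - smul r v) - smul r (smul a' y - smul r' v)"
        by (simp add: algebra_simps)
      then have "smul (r' * a) x + smul (- (r * a')) y \<in> W"
        using a a' subspace_scale[OF sW] subspace_diff[OF sW] by metis
      then show ?thesis using False a' by (metis mult_eq_0_iff neg_equal_0_iff_equal)
    qed
  qed
  let ?t = "monom 1 1 :: 'f poly"
  have var_dvd: "\<exists>p'. p = ?t * p'" if "coeff p 0 = 0" for p :: "'f poly"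
    using that by (cases p) (auto simp: monom_Suc intro!: exI)
  \<comment> \<open>\<open>N\<close> modulo \<open>W\<close> has rank one, so \<open>N\<close> modulo \<open>W + tN\<close> has dimension at most one.\<close>
  have "\<exists>G. finite G \<and> G \<subseteq> N \<and> (\<forall>x\<in>N. \<exists>g\<in>span G. \<exists>y\<in>N. x = g + smul ?t y)"
  proof (cases "\<forall>x\<in>N. \<exists>g\<in>W. \<exists>y\<in>N. x = g + smul ?t y")
    case True
    then show ?thesis using W WN span_superset[of G0] by (intro exI[of _ G0]) auto
  next
    case False
    then obtain y0 where y0: "y0 \<in> N" "\<And>g y. g \<in> W \<Longrightarrow> y \<in> N \<Longrightarrow> y0 \<noteq> g + smul ?t y" by blast
    have "\<exists>g\<in>span (insert y0 G0). \<exists>y\<in>N. x = g + smul ?t y" if x: "x \<in> N" for x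
    proof -
      obtain a b where ab: "a \<noteq> 0 \<or> b \<noteq> 0" "smul a x + smul b y0 \<in> W" using rel[OF x y0(1)] by blast
      obtain z r s where z: "z \<in> N" "x - smul r z \<in> W" "y0 - smul s z \<in> W"
        by (rule merge[OF W(1) sN NV x y0(1) ab])
      have s0: "coeff s 0 \<noteq> 0"
      proof
        assume "coeff s 0 = 0"
        then obtain s' where s': "s = ?t * s'" using var_dvd by blast
        have "y0 = (y0 - smul s z) + smul ?t (smul s' z)" by (simp add: s')
        then show False using y0(2)[OF z(3) subspace_scale[OF sN z(1)]] by blast
      qed
      define k where "k = [:coeff r 0 / coeff s 0:]"
      have "coeff (r - k * s) 0 = 0" using s0 by (simp add: k_def)
      then obtain e where e: "r - k * s = ?t * e" using var_dvd by blast
      define w where "w = (x - smul r z) - smul k (y0 - smul s z)"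
      have "w \<in> W" unfolding w_def using z subspace_diff[OF sW] subspace_scale[OF sW] by blast
      moreover have "x - smul k y0 - w = smul (r - k * s) z"
        unfolding w_def by (simp add: algebra_simps)
      then have "x = (w + smul k y0) + smul ?t (smul e z)"
        unfolding e by (simp add: algebra_simps)
      moreover have "w + smul k y0 \<in> span (insert y0 G0)"
        using \<open>w \<in> W\<close> W(3) span_mono[of G0 "insert y0 G0"]
        by (intro span_add span_scale) (auto intro: span_base)
      ultimately show ?thesis using subspace_scale[OF sN z(1)] by blast
    qed
    then show ?thesis
      using W WN span_superset[of G0] y0 by (intro exI[of _ "insert y0 G0"]) auto
  qed
  then obtain G where G: "finite G" "G \<subseteq> N"
      "\<And>x. x \<in> N \<Longrightarrow> \<exists>g\<in>span G. \<exists>y\<in>N. x = g + smul ?t y" by metis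
  obtain G' where G': "finite G'" "span G' = N"
    by (rule finitely_generated_if_mod_variable[OF sN NV G])
  have G'N: "G' \<subseteq> N" using G' span_superset by blast
  obtain b where b: "b \<in> N" "\<And>x. x \<in> G' \<Longrightarrow> \<exists>r. x - smul r b \<in> W"
    using merge_finite[OF W(1) sN NV rel G'(1) G'N] by blast
  define W' where "W' = {x. \<exists>k. x - smul k b \<in> W}"
  have W'_eq: "W' = span (insert b G0)"
    unfolding W'_def span_insert W(3) ..
  have "N \<subseteq> W'"
    using span_minimal[of G' W'] b(2) G' subspace_span[of "insert b G0"]
    unfolding W'_eq[symmetric] by (auto simp: W'_def)
  moreover have "W' \<subseteq> N"
    unfolding W'_eq using b WN span_superset[of G0] W(3) by (intro span_minimal sN) auto
  ultimately have W'N: "W' = N" by blast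
  have "b \<notin> W"
  proof
    assume bW: "b \<in> W"
    obtain k where "v - smul k b \<in> W" using vN W'N unfolding W'_def by blast
    then have "v \<in> W" using subspace_add[OF sW _ subspace_scale[OF sW bW, of k]] by fastforce
    then show False using v by blast
  qed
  moreover have "saturated N"
    unfolding saturated_def
  proof (intro conjI ballI allI impI)
    fix x a assume x: "x \<in> V" "a \<noteq> 0" "smul a x \<in> N"
    from x(3) obtain a' r where a': "a' \<noteq> 0" "smul a' (smul a x) - smul r v \<in> W" by (rule NE)
    then show "x \<in> N" using x by (intro NI[of x "a' * a" r]) auto
  qed (rule sN NV)+
  moreover have "b \<in> V" using b NV by blast
  ultimately show thesis
    using that[of b "insert b G0"] W(2) vN unfolding W'_def[symmetric] W'_eq[symmetric] W'N by simp
qed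

end

text \<open>
  Exponential growth of the number of points is what makes the rank infinite.
\<close>

locale plentiful_height_module = height_module +
  fixes e s :: nat
  assumes plentiful: "\<And>n. 2 ^ n \<le> card {x \<in> V. H x \<le> e * n + s}"
begin

text \<open>
  If \<open>V\<close> were finitely generated, then \<open>V = R + t\<^sup>dV\<close> for a finite set \<open>R\<close>, and all points of height at
  most \<open>2n + k\<close> would come from \<open>R\<close> and the points of height at most \<open>n + k\<close>. So the number of points of
  height at most \<open>2\<^sup>j + k\<close> would be at most exponential in \<open>j\<close>, but it is doubly exponential.
\<close>

lemma not_finitely_generated:
  assumes G: "finite G"
  shows "span G \<noteq> V"
proof
  assume GV: "span G = V"
  have GV': "G \<subseteq> V" using GV span_superset by blast
  have "\<exists>g\<in>span G. \<exists>y\<in>V. x = g + smul (monom 1 d) y" if "x \<in> V" for x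
    using that GV subspace_0[OF subspace_V] by (intro bexI[of _ x] bexI[of _ 0]) auto
  from finite_residues[OF subspace_V G GV' this]
  obtain R where R: "finite R" "R \<subseteq> V" "\<And>x. x \<in> V \<Longrightarrow> \<exists>r\<in>R. \<exists>y\<in>V. x = r + smul (monom 1 d) y"
    by metis
  obtain h where h: "\<And>r. r \<in> R \<Longrightarrow> H r \<le> h"
    using R(1) by (meson finite_imageI finite_nat_set_iff_bounded_le imageI)
  define B where "B n = {x \<in> V. H x \<le> n}" for n
  have finB: "finite (B n)" for n unfolding B_def by (rule northcott)
  \<comment> \<open>The offset \<open>h + c\<close> is the fixed point of the recursion for the height bound.\<close>
  have double: "card (B (2 * n + (h + c))) \<le> card R * card (B (n + (h + c)))" for n
  proof -
    have "B (2 * n + (h + c)) \<subseteq> (\<lambda>(r, y). r + smul (monom 1 d) y) ` (R \<times> B (n + (h + c)))"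
    proof
      fix x assume "x \<in> B (2 * n + (h + c))"
      then have x: "x \<in> V" "H x \<le> 2 * n + (h + c)" by (auto simp: B_def)
      obtain r y where ry: "r \<in> R" "y \<in> V" "x = r + smul (monom 1 d) y" using R(3)[OF x(1)] by blast
      have "2 * H y \<le> H (x - r) + c" using expanding[of y] ry by auto
      also have "\<dots> \<le> H x + h + c" using height_diff[of x r] x ry R h[OF ry(1)] by fastforce
      finally have "H y \<le> n + (h + c)" using x by simp
      then show "x \<in> (\<lambda>(r, y). r + smul (monom 1 d) y) ` (R \<times> B (n + (h + c)))"
        using ry by (auto simp: B_def image_iff)
    qed
    then have "card (B (2 * n + (h + c))) \<le> card (R \<times> B (n + (h + c)))"
      by (intro surj_card_le) (auto simp: R finB)
    then show ?thesis by (simp add: card_cartesian_product)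
  qed
  have growth: "card (B (2 ^ j + (h + c))) \<le> card R ^ j * card (B (1 + (h + c)))" for j
  proof (induction j)
    case (Suc j)
    have "card (B (2 ^ Suc j + (h + c))) \<le> card R * card (B (2 ^ j + (h + c)))"
      using double[of "2 ^ j"] by simp
    also have "\<dots> \<le> card R * (card R ^ j * card (B (1 + (h + c))))"
      using Suc by (rule mult_left_mono) simp
    finally show ?case by simp
  qed simp
  define m where "m = card R + card (B (1 + (h + c)))"
  have m: "card R \<le> 2 ^ m" "card (B (1 + (h + c))) \<le> 2 ^ m"
    unfolding m_def using self_le_power[of 2 "_ :: nat"] by (meson le_add1 le_add2 less_exp nless_le order.trans power_increasing one_le_numeral)+
  obtain j where j: "(e * m) * j + (e * (m + 1) + s) \<le> (2::nat) ^ j"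
    using exists_power_two_ge_linear by blast
  define n where "n = m * j + m + 1"
  have "e * n + s \<le> 2 ^ j + (h + c)" using j by (simp add: n_def algebra_simps)
  then have "{x \<in> V. H x \<le> e * n + s} \<subseteq> B (2 ^ j + (h + c))" by (auto simp: B_def)
  then have "2 ^ n \<le> card (B (2 ^ j + (h + c)))"
    using plentiful[of n] card_mono[OF finB] by (meson le_trans)
  also have "\<dots> \<le> card R ^ j * card (B (1 + (h + c)))" by (rule growth)
  also have "\<dots> \<le> (2 ^ m) ^ j * 2 ^ m"
    using m by (intro mult_mono power_mono) auto
  also have "\<dots> = 2 ^ (m * j + m)" by (simp add: power_mult power_add)
  finally show False by (simp add: n_def)
qed

text \<open>
  \<open>W n\<close> is the saturated module spanned by the torsion and the first \<open>n\<close> basis elements. It is required to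
  contain the first \<open>n\<close> points of an enumeration \<open>v\<close> of \<open>V\<close>, so that the union of all \<open>W n\<close> is \<open>V\<close>.
\<close>

lemma poonen_mordell_weil_if_plentiful: "poonen_mordell_weil smul V"
proof -
  let ?tor = "torsion smul V"
  define ext where "ext W b = {x. \<exists>k. x - smul k b \<in> W}" for W b
  define good where "good W \<longleftrightarrow> saturated W \<and> (\<exists>G. finite G \<and> span G = W)" for W
  have V_eq: "V = (\<Union>n. {x \<in> V. H x \<le> n})" by auto
  have "countable (\<Union>n. {x \<in> V. H x \<le> n})"
    by (rule countable_UN) (auto intro: countable_finite northcott)
  then have "countable V" unfolding V_eq[symmetric] .
  moreover have "V \<noteq> {}" using subspace_0[OF subspace_V] by blast
  moreover define v where "v = from_nat_into V"
  ultimately have v: "range v = V" by (simp add: range_from_nat_into)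
  have good0: "good ?tor"
  proof -
    have "span ?tor = ?tor" using saturated_torsion by (simp add: saturated_def)
    then show ?thesis using saturated_torsion finite_torsion unfolding good_def by blast
  qed
  have step: "\<exists>W'. good W' \<and> (\<exists>b\<in>V. b \<notin> W \<and> v n \<in> W' \<and> W' = ext W b)" if W: "good W" for W n
  proof -
    have "W \<noteq> V" using W not_finitely_generated unfolding good_def by blast
    then obtain u where u: "u \<in> V" "u \<notin> W" using W unfolding good_def saturated_def by blast
    define w where "w = (if v n \<in> W then u else v n)"
    have w: "w \<in> V" "w \<notin> W" using u v by (auto simp: w_def)
    obtain G0 where G0: "saturated W" "finite G0" "span G0 = W" using W unfolding good_def by blast
    obtain b G where b: "b \<in> V" "b \<notin> W" "saturated (ext W b)" "w \<in> ext W b" "finite G" "span G = ext W b"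
      by (rule saturated_extension[OF G0 w, folded ext_def])
    have "W \<subseteq> ext W b"
      unfolding ext_def by (auto intro!: exI[of _ 0])
    then have "v n \<in> ext W b" using b(4) by (auto simp: w_def split: if_splits)
    then show ?thesis using b unfolding good_def by blast
  qed
  obtain W where W0: "W 0 = ?tor" and good: "\<And>n. good (W n)"
    and W: "\<And>n. \<exists>b\<in>V. b \<notin> W n \<and> v n \<in> W (Suc n) \<and> W (Suc n) = ext (W n) b"
  proof -
    have "\<exists>f. \<forall>n. (good (f n) \<and> (n = 0 \<longrightarrow> f n = ?tor)) \<and>
        (\<exists>b\<in>V. b \<notin> f n \<and> v n \<in> f (Suc n) \<and> f (Suc n) = ext (f n) b)"
      by (rule dependent_nat_choice) (use good0 step in auto)
    then show thesis using that by blast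
  qed
  obtain b where b: "\<And>n. b n \<in> V" "\<And>n. b n \<notin> W n" "\<And>n. v n \<in> W (Suc n)"
      "\<And>n. W (Suc n) = ext (W n) (b n)"
    using W by metis
  have sub: "subspace (W n)" and satW: "\<And>x a. x \<in> V \<Longrightarrow> a \<noteq> 0 \<Longrightarrow> smul a x \<in> W n \<Longrightarrow> x \<in> W n" for n
    using good unfolding good_def saturated_def by blast+
  have bW: "b n \<in> W (Suc n)" for n
    unfolding b(4) ext_def using subspace_0[OF sub] by (auto intro!: exI[of _ 1])
  have Wmono: "W m \<subseteq> W n" if "m \<le> n" for m n
    using that by (rule lift_Suc_mono_le[rotated]) (auto simp: b(4) ext_def intro!: exI[of _ 0])
  have bWlt: "b m \<in> W n" if "m < n" for m n
    using bW[of m] Wmono[of "Suc m" n] that by auto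
  define F where "F = span (range b)"
  have sF: "subspace F" unfolding F_def by simp
  \<comment> \<open>The last term of a nontrivial combination cannot lie in the module spanned by the others.\<close>
  have coeff0: "u i = 0" if I: "finite I" "(\<Sum>i\<in>I. smul (u i) (b i)) \<in> ?tor" "i \<in> I" for I u i
  proof (rule ccontr)
    assume "u i \<noteq> 0"
    define J where "J = {i \<in> I. u i \<noteq> 0}"
    have J: "finite J" "J \<noteq> {}" using I \<open>u i \<noteq> 0\<close> by (auto simp: J_def)
    define m where "m = Max J"
    have m: "m \<in> J" using J by (simp add: m_def)
    have "(\<Sum>i\<in>I. smul (u i) (b i)) = (\<Sum>i\<in>J. smul (u i) (b i))"
      using I by (intro sum.mono_neutral_right) (auto simp: J_def)
    also have "\<dots> = smul (u m) (b m) + (\<Sum>i\<in>J - {m}. smul (u i) (b i))"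
      by (rule sum.remove[OF J(1) m])
    finally have eq: "smul (u m) (b m) = (\<Sum>i\<in>I. smul (u i) (b i)) - (\<Sum>i\<in>J - {m}. smul (u i) (b i))"
      by simp
    have "(\<Sum>i\<in>J - {m}. smul (u i) (b i)) \<in> W m"
    proof (intro subspace_sum[OF sub] subspace_scale[OF sub] bWlt)
      fix i assume "i \<in> J - {m}"
      then have "i \<le> m" "i \<noteq> m" using J by (auto simp: m_def)
      then show "i < m" by simp
    qed
    moreover have "(\<Sum>i\<in>I. smul (u i) (b i)) \<in> W m" using I W0 Wmono[of 0 m] by auto
    ultimately have "smul (u m) (b m) \<in> W m" unfolding eq using subspace_diff[OF sub] by blast
    moreover have "u m \<noteq> 0" using m by (simp add: J_def)
    ultimately show False using satW b by blast
  qed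
  have injb: "inj b"
  proof (rule linorder_injI)
    show "b m \<noteq> b n" if "m < n" for m n using bWlt[OF that] b(2)[of n] by auto
  qed
  have F_elem: "\<exists>I u. finite I \<and> x = (\<Sum>i\<in>I. smul (u i) (b i))" if x: "x \<in> F" for x
  proof -
    obtain t r where t: "finite t" "t \<subseteq> range b" "x = (\<Sum>a\<in>t. smul (r a) a)"
      using x unfolding F_def span_explicit mem_Collect_eq
      by (elim exE conjE) (rule that, assumption+)
    obtain I where I: "t = b ` I" using t(2) by (auto simp: subset_image_iff)
    have "finite I" using t(1) injb unfolding I by (metis finite_imageD inj_on_subset subset_UNIV)
    moreover have "x = (\<Sum>i\<in>I. smul (r (b i)) (b i))"
      unfolding t(3) I using injb by (subst sum.reindex) (auto intro: inj_on_subset)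
    ultimately show ?thesis by (intro exI[of _ I] exI[of _ "\<lambda>i. r (b i)"]) auto
  qed
  have tors_F: "?tor \<inter> F = {0}"
  proof -
    have "x = 0" if x: "x \<in> ?tor" "x \<in> F" for x
    proof -
      obtain I u where Iu: "finite I" "x = (\<Sum>i\<in>I. smul (u i) (b i))" using F_elem[OF x(2)]
        by (elim exE conjE) (rule that, assumption+)
      have "u i = 0" if "i \<in> I" for i
        by (rule coeff0[of I u i, folded Iu(2), OF Iu(1) x(1) that])
      then show ?thesis unfolding Iu(2) by simp
    qed
    moreover have "0 \<in> ?tor" using sub[of 0] W0 subspace_0 by auto
    ultimately show ?thesis using subspace_0[OF sF] by blast
  qed
  have indep: "independent (range b)"
  proof
    assume "dependent (range b)"
    then obtain t u v where t: "finite t" "t \<subseteq> range b" "(\<Sum>v\<in>t. smul (u v) v) = 0" "v \<in> t" "u v \<noteq> 0"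
      unfolding dependent_explicit by (elim exE conjE bexE) (rule that, assumption+)
    obtain I where I: "t = b ` I" using t(2) by (auto simp: subset_image_iff)
    have "finite I" using t(1) injb unfolding I by (metis finite_imageD inj_on_subset subset_UNIV)
    moreover have "(\<Sum>i\<in>I. smul (u (b i)) (b i)) = 0"
      using t(3) injb unfolding I by (subst (asm) sum.reindex) (auto intro: inj_on_subset)
    moreover have "0 \<in> ?tor" using tors_F by blast
    ultimately have "u (b i) = 0" if "i \<in> I" for i
      using coeff0[of I "\<lambda>i. u (b i)"] that by simp
    then show False using t I by blast
  qed
  have W_sum: "\<exists>y\<in>?tor. \<exists>z\<in>F. x = y + z" if "x \<in> W n" for x n
    using that
  proof (induction n arbitrary: x)
    case 0
    then show ?case using W0 subspace_0[OF sF] by (intro bexI[of _ x] bexI[of _ 0]) auto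
  next
    case (Suc n)
    obtain k where "x - smul k (b n) \<in> W n" using Suc.prems unfolding b(4) ext_def by blast
    then obtain y z where yz: "y \<in> ?tor" "z \<in> F" "x - smul k (b n) = y + z" using Suc.IH by blast
    then have "x = y + (z + smul k (b n))" by (simp add: algebra_simps)
    moreover have "z + smul k (b n) \<in> F"
      using yz(2) subspace_add[OF sF] subspace_scale[OF sF] span_base[of "b n" "range b"]
      by (auto simp: F_def)
    ultimately show ?case using yz by blast
  qed
  have "F \<subseteq> V" unfolding F_def using b by (intro span_minimal subspace_V) auto
  moreover have "?tor \<subseteq> V" by (auto simp: torsion_def)
  ultimately have sup: "{x + y | x y. x \<in> ?tor \<and> y \<in> F} \<subseteq> V"
    using subspace_add[OF subspace_V] by blast
  have "x \<in> {x + y | x y. x \<in> ?tor \<and> y \<in> F}" if "x \<in> V" for x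
  proof -
    have "x \<in> range v" using that v by simp
    then obtain n where "x = v n" by blast
    then show ?thesis using W_sum[OF b(3)[of n]] by blast
  qed
  with sup have "V = {x + y | x y. x \<in> ?tor \<and> y \<in> F}" by blast
  moreover have "countable (range b)" "infinite (range b)"
    using injb by (auto dest: finite_imageD)
  ultimately show ?thesis
    unfolding poonen_mordell_weil_def using finite_torsion sF tors_F indep F_def by blast
qed

end

section \<open>Heights of tuples of rational functions\<close>

definition of_poly :: "'a::idom \<Rightarrow> 'a fract" where
  "of_poly p = Fract p 1"

lemma of_poly_hom [simp]:
  fixes p r :: "'a::idom"
  shows "of_poly (p + r) = of_poly p + of_poly r"
    and "of_poly (p * r) = of_poly p * of_poly r"
    and "of_poly (1 :: 'a) = 1"
    and "of_poly (0 :: 'a) = 0"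
  by (simp_all add: of_poly_def One_fract_def Zero_fract_def)

lemma of_poly_power [simp]: "of_poly (p ^ n) = of_poly p ^ n"
  by (induction n) simp_all

lemma of_poly_eq_iff [simp]: "of_poly p = of_poly r \<longleftrightarrow> p = (r :: 'a::idom)"
  by (simp add: of_poly_def eq_fract)

lemma of_poly_eq_0_iff [simp]: "of_poly p = 0 \<longleftrightarrow> p = (0 :: 'a::idom)"
  using of_poly_eq_iff[of p 0] by (simp del: of_poly_eq_iff)

lemma of_poly_sum: "of_poly (\<Sum>i\<in>A. f i) = (\<Sum>i\<in>A. of_poly (f i :: 'a::idom))"
  by (induction A rule: infinite_finite_induct) simp_all

text \<open>
  The least such \<open>n\<close> is the height of the point \<open>(1 : \<dots> : y\<^sub>i : \<dots>)\<close> of projective space.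
\<close>

definition tuple_bound :: "'i set \<Rightarrow> ('i \<Rightarrow> 'f::field poly fract) \<Rightarrow> nat \<Rightarrow> bool" where
  "tuple_bound I y n \<longleftrightarrow> (\<exists>D a. D \<noteq> 0 \<and> degree D \<le> n \<and>
     (\<forall>i\<in>I. degree (a i) \<le> n \<and> of_poly D * y i = of_poly (a i)))"

lemma tuple_boundI:
  assumes "D \<noteq> 0" "degree D \<le> n" "\<And>i. i \<in> I \<Longrightarrow> degree (a i) \<le> n"
    "\<And>i. i \<in> I \<Longrightarrow> of_poly D * y i = of_poly (a i)"
  shows "tuple_bound I y n"
  using assms unfolding tuple_bound_def by blast

lemma tuple_boundE:
  assumes "tuple_bound I y n"
  obtains D a where "D \<noteq> 0" "degree D \<le> n" "\<forall>i\<in>I. degree (a i) \<le> n"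
    "\<forall>i\<in>I. of_poly D * y i = of_poly (a i)"
  using assms unfolding tuple_bound_def by blast

lemma tuple_bound_mono: "tuple_bound I y m \<Longrightarrow> m \<le> n \<Longrightarrow> tuple_bound I y n"
  unfolding tuple_bound_def by (meson le_trans)

lemma tuple_bound_subset: "tuple_bound I y n \<Longrightarrow> J \<subseteq> I \<Longrightarrow> tuple_bound J y n"
  unfolding tuple_bound_def by blast

lemma degree_mult_le_add: "degree p \<le> m \<Longrightarrow> degree r \<le> n \<Longrightarrow> degree (p * r) \<le> m + n"
  by (meson add_mono degree_mult_le le_trans)

lemma tuple_bound_exists:
  assumes "finite I"
  shows "\<exists>n. tuple_bound I y n"
proof -
  have "\<exists>D a. D \<noteq> 0 \<and> (\<forall>i\<in>I. of_poly D * y i = of_poly (a i))"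
    using assms
  proof (induction I rule: finite_induct)
    case empty
    then show ?case by (intro exI[of _ 1]) auto
  next
    case (insert j I)
    then obtain D a where Da: "D \<noteq> 0" "\<And>i. i \<in> I \<Longrightarrow> of_poly D * y i = of_poly (a i)" by blast
    obtain p r where pr: "y j = Fract p r" "r \<noteq> 0" by (cases "y j") auto
    have yj: "of_poly r * y j = of_poly p" using pr by (simp add: of_poly_def eq_fract)
    define a' where "a' = (\<lambda>i. if i = j then D * p else r * a i)"
    have "of_poly (D * r) * y i = of_poly (a' i)" if "i \<in> insert j I" for i
      using that insert.hyps Da yj by (auto simp: a'_def mult_ac)
    then show ?case using Da(1) pr(2)
      by (intro exI[of _ "D * r"] exI[of _ a']) auto
  qed
  then obtain D a where Da: "D \<noteq> 0" "\<And>i. i \<in> I \<Longrightarrow> of_poly D * y i = of_poly (a i)" by blast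
  define n where "n = degree D + (\<Sum>i\<in>I. degree (a i))"
  have "degree (a i) \<le> n" if "i \<in> I" for i
    using member_le_sum[of i I "\<lambda>i. degree (a i)"] that assms by (simp add: n_def trans_le_add2)
  then show ?thesis using Da by (intro exI[of _ n] tuple_boundI[of D n I a]) (auto simp: n_def)
qed

lemma tuple_bound_Un:
  assumes "tuple_bound I y m" "tuple_bound J y n"
  shows "tuple_bound (I \<union> J) y (m + n)"
proof -
  obtain D a where Da: "D \<noteq> 0" "degree D \<le> m" "\<forall>i\<in>I. degree (a i) \<le> m"
    "\<forall>i\<in>I. of_poly D * y i = of_poly (a i)" using assms(1) by (rule tuple_boundE)
  note Da = Da[rule_format]
  obtain E b where Eb: "E \<noteq> 0" "degree E \<le> n" "\<forall>i\<in>J. degree (b i) \<le> n"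
    "\<forall>i\<in>J. of_poly E * y i = of_poly (b i)" using assms(2) by (rule tuple_boundE)
  note Eb = Eb[rule_format]
  show ?thesis
  proof (rule tuple_boundI)
    show "D * E \<noteq> 0" "degree (D * E) \<le> m + n"
      using Da Eb by (auto intro: degree_mult_le_add)
    fix i assume i: "i \<in> I \<union> J"
    show "degree (if i \<in> I then a i * E else D * b i) \<le> m + n"
      using i Da Eb by (auto intro: degree_mult_le_add)
    show "of_poly (D * E) * y i = of_poly (if i \<in> I then a i * E else D * b i)"
      using i Da Eb by (auto simp: mult_ac simp flip: Da(4) Eb(4))
  qed
qed

lemma tuple_bound_reindex:
  "tuple_bound I (\<lambda>i. y (f i)) n \<longleftrightarrow> tuple_bound (f ` I) y n"
proof
  assume "tuple_bound (f ` I) y n"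
  then obtain D a where Da: "D \<noteq> 0" "degree D \<le> n" "\<forall>i\<in>f ` I. degree (a i) \<le> n"
    "\<forall>i\<in>f ` I. of_poly D * y i = of_poly (a i)" by (rule tuple_boundE)
  note Da = Da[rule_format]
  then show "tuple_bound I (\<lambda>i. y (f i)) n"
    by (intro tuple_boundI[of D n I "\<lambda>i. a (f i)"]) auto
next
  assume "tuple_bound I (\<lambda>i. y (f i)) n"
  then obtain D a where Da: "D \<noteq> 0" "degree D \<le> n" "\<forall>i\<in>I. degree (a i) \<le> n"
    "\<forall>i\<in>I. of_poly D * y (f i) = of_poly (a i)" by (rule tuple_boundE)
  note Da = Da[rule_format]
  then show "tuple_bound (f ` I) y n"
    by (intro tuple_boundI[of D n "f ` I" "\<lambda>j. a (inv_into I f j)"])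
      (auto simp: inv_into_into f_inv_into_f simp flip: Da(4))
qed

lemma tuple_bound_diff:
  assumes "tuple_bound I y m" "tuple_bound I z n"
  shows "tuple_bound I (\<lambda>i. y i - z i) (m + n)"
proof -
  obtain D a where Da: "D \<noteq> 0" "degree D \<le> m" "\<forall>i\<in>I. degree (a i) \<le> m"
    "\<forall>i\<in>I. of_poly D * y i = of_poly (a i)" using assms(1) by (rule tuple_boundE)
  note Da = Da[rule_format]
  obtain E b where Eb: "E \<noteq> 0" "degree E \<le> n" "\<forall>i\<in>I. degree (b i) \<le> n"
    "\<forall>i\<in>I. of_poly E * z i = of_poly (b i)" using assms(2) by (rule tuple_boundE)
  note Eb = Eb[rule_format]
  show ?thesis
  proof (rule tuple_boundI)
    show "D * E \<noteq> 0" "degree (D * E) \<le> m + n"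
      using Da Eb by (auto intro: degree_mult_le_add)
    fix i assume i: "i \<in> I"
    show "degree (a i * E - D * b i) \<le> m + n"
      using i Da Eb by (intro degree_diff_le degree_mult_le_add) auto
    have "of_poly (a i * E) = of_poly (a i * E - D * b i) + of_poly (D * b i)"
      unfolding of_poly_hom(1)[symmetric] by simp
    then have "of_poly (a i * E - D * b i) = of_poly (a i) * of_poly E - of_poly D * of_poly (b i)"
      by simp
    also have "\<dots> = of_poly (D * E) * (y i - z i)"
      unfolding Da(4)[OF i, symmetric] Eb(4)[OF i, symmetric] by (simp add: algebra_simps)
    finally show "of_poly (D * E) * (y i - z i) = of_poly (a i * E - D * b i)" ..
  qed
qed

lemma tuple_bound_linear:
  fixes A :: "'j \<Rightarrow> 'i \<Rightarrow> 'f::field poly fract"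
  assumes "finite I" "finite J"
  shows "\<exists>c. \<forall>y n. tuple_bound I y n \<longrightarrow> tuple_bound J (\<lambda>j. \<Sum>i\<in>I. A j i * y i) (n + c)"
proof -
  obtain c where c: "tuple_bound (J \<times> I) (\<lambda>z. A (fst z) (snd z)) c"
    using tuple_bound_exists[OF finite_cartesian_product[OF assms(2,1)]] by metis
  obtain E b where Eb: "E \<noteq> 0" "degree E \<le> c" "\<forall>i\<in>J \<times> I. degree (b i) \<le> c"
    "\<forall>i\<in>J \<times> I. of_poly E * A (fst i) (snd i) = of_poly (b i)"
    using c by (rule tuple_boundE)
  note Eb = Eb[rule_format]
  have "tuple_bound J (\<lambda>j. \<Sum>i\<in>I. A j i * y i) (n + c)" if "tuple_bound I y n" for y n
  proof -
    obtain D a where Da: "D \<noteq> 0" "degree D \<le> n" "\<forall>i\<in>I. degree (a i) \<le> n"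
      "\<forall>i\<in>I. of_poly D * y i = of_poly (a i)" using \<open>tuple_bound I y n\<close> by (rule tuple_boundE)
    note Da = Da[rule_format]
    show ?thesis
    proof (rule tuple_boundI)
      show "D * E \<noteq> 0" "degree (D * E) \<le> n + c"
        using Da Eb by (auto intro: degree_mult_le_add)
      fix j assume j: "j \<in> J"
      show "degree (\<Sum>i\<in>I. a i * b (j, i)) \<le> n + c"
        using j Da Eb by (intro degree_sum_le degree_mult_le_add assms) auto
      have "of_poly (\<Sum>i\<in>I. a i * b (j, i)) = (\<Sum>i\<in>I. (of_poly D * y i) * (of_poly E * A j i))"
        unfolding of_poly_sum using Da(4) Eb(4)[of "(j, _)"] j by (intro sum.cong) auto
      then show "of_poly (D * E) * (\<Sum>i\<in>I. A j i * y i) = of_poly (\<Sum>i\<in>I. a i * b (j, i))"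
        by (simp add: sum_distrib_left mult_ac)
    qed
  qed
  then show ?thesis by blast
qed

lemma tuple_bound_finite:
  fixes g :: "'i \<Rightarrow> 'v \<Rightarrow> 'f::{finite,field} poly fract"
  assumes I: "finite I" and inj: "\<And>x y. x \<in> S \<Longrightarrow> y \<in> S \<Longrightarrow> (\<And>i. i \<in> I \<Longrightarrow> g i x = g i y) \<Longrightarrow> x = y"
  shows "finite {x \<in> S. tuple_bound I (\<lambda>i. g i x) n}"
proof -
  define P where "P = {p :: 'f poly. degree p \<le> n}"
  define Q where "Q = (\<lambda>(p, r). Fract p r) ` (P \<times> P)"
  have "finite (PiE I (\<lambda>_. Q))"
    unfolding Q_def P_def by (intro finite_PiE I finite_imageI finite_cartesian_product finite_poly_degree_le)
  moreover have "(\<lambda>x. restrict (\<lambda>i. g i x) I) ` {x \<in> S. tuple_bound I (\<lambda>i. g i x) n} \<subseteq> PiE I (\<lambda>_. Q)"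
  proof clarify
    fix x assume "tuple_bound I (\<lambda>i. g i x) n"
    then obtain D a where Da: "D \<noteq> 0" "degree D \<le> n" "\<forall>i\<in>I. degree (a i) \<le> n"
      "\<forall>i\<in>I. of_poly D * g i x = of_poly (a i)" by (rule tuple_boundE)
    note Da = Da[rule_format]
    have "g i x = Fract (a i) D" if "i \<in> I" for i
    proof -
      have "of_poly D * g i x = of_poly D * Fract (a i) D"
        using Da(1) unfolding Da(4)[OF that] by (simp add: of_poly_def eq_fract)
      then show ?thesis using Da(1) by simp
    qed
    then have "g i x \<in> Q" if "i \<in> I" for i
      using that Da(2,3) by (auto simp: Q_def P_def)
    then show "restrict (\<lambda>i. g i x) I \<in> PiE I (\<lambda>_. Q)" by auto
  qed
  ultimately have "finite ((\<lambda>x. restrict (\<lambda>i. g i x) I) ` {x \<in> S. tuple_bound I (\<lambda>i. g i x) n})"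
    by (rule finite_subset[rotated])
  moreover have "inj_on (\<lambda>x. restrict (\<lambda>i. g i x) I) {x \<in> S. tuple_bound I (\<lambda>i. g i x) n}"
    by (rule inj_onI) (metis (no_types, lifting) inj mem_Collect_eq restrict_apply')
  ultimately show ?thesis by (rule finite_imageD)
qed

text \<open>
  \<open>D\<close> and the numerators have no common factor, expressed by a Bezout identity. They arise from any
  common denominator \<open>E\<close> and its numerators through division by a generator of the ideal that these span.
\<close>

lemma reduced_common_denominator:
  fixes y :: "'i \<Rightarrow> 'f::field poly fract"
  assumes "finite I"
  obtains D a u w where "D \<noteq> 0" "\<forall>i\<in>I. of_poly D * y i = of_poly (a i)"
    "w * D + (\<Sum>i\<in>I. u i * a i) = 1"
proof -
  obtain n where "tuple_bound I y n" using tuple_bound_exists[OF assms] by blast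
  then obtain E b where Eb: "E \<noteq> 0" "\<forall>i\<in>I. of_poly E * y i = of_poly (b i)"
    by (rule tuple_boundE)
  note Eb = Eb[rule_format]
  define J where "J = {w * E + (\<Sum>i\<in>I. u i * b i) | w u. True}"
  have JI: "w * E + (\<Sum>i\<in>I. u i * b i) \<in> J" for w u unfolding J_def by blast
  have EJ: "E \<in> J" using JI[of 1 "\<lambda>_. 0"] by simp
  have bJ: "b i \<in> J" if "i \<in> I" for i
  proof -
    have "(\<Sum>j\<in>I. (if j = i then 1 else 0) * b j) = (\<Sum>j\<in>I. if j = i then b j else 0)"
      by (intro sum.cong) auto
    then show ?thesis using JI[of 0 "\<lambda>j. if j = i then 1 else 0"] that assms by simp
  qed
  have add: "p + r \<in> J" if p: "p \<in> J" and r: "r \<in> J" for p r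
  proof -
    obtain w u where "p = w * E + (\<Sum>i\<in>I. u i * b i)" using p unfolding J_def by blast
    moreover obtain w' u' where "r = w' * E + (\<Sum>i\<in>I. u' i * b i)" using r unfolding J_def by blast
    ultimately have "p + r = (w + w') * E + (\<Sum>i\<in>I. (u i + u' i) * b i)"
      by (simp add: algebra_simps sum.distrib)
    then show ?thesis using JI by metis
  qed
  have mult: "s * p \<in> J" if p: "p \<in> J" for s p
  proof -
    obtain w u where "p = w * E + (\<Sum>i\<in>I. u i * b i)" using p unfolding J_def by blast
    then have "s * p = (s * w) * E + (\<Sum>i\<in>I. (s * u i) * b i)"
      by (simp add: algebra_simps sum_distrib_left)
    then show ?thesis using JI by metis
  qed
  obtain g where g: "g \<in> J" "g \<noteq> 0" "\<And>x. x \<in> J \<Longrightarrow> g dvd x"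
    using poly_ideal_generator[OF EJ Eb(1) add mult] by blast
  obtain w u where gwu: "g = w * E + (\<Sum>i\<in>I. u i * b i)" using g(1) unfolding J_def by blast
  obtain D where D: "E = g * D" using g(3)[OF EJ] by (rule dvdE)
  define a where "a i = b i div g" for i
  have a: "b i = g * a i" if "i \<in> I" for i using g(3)[OF bJ[OF that]] by (simp add: a_def)
  have "g * (w * D + (\<Sum>i\<in>I. u i * a i)) = w * E + (\<Sum>i\<in>I. u i * b i)"
    unfolding D using a by (simp add: algebra_simps sum_distrib_left)
  then have "g * (w * D + (\<Sum>i\<in>I. u i * a i)) = g * 1" using gwu by simp
  then have "w * D + (\<Sum>i\<in>I. u i * a i) = 1" using g(2) mult_left_cancel by blast
  moreover have "of_poly D * y i = of_poly (a i)" if "i \<in> I" for i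
  proof -
    have "of_poly g * (of_poly D * y i) = of_poly g * of_poly (a i)"
      using Eb(2)[OF that] a[OF that] D by (simp add: mult.assoc)
    then show ?thesis using g(2) by simp
  qed
  moreover have "D \<noteq> 0" using D Eb(1) by auto
  ultimately show thesis using that by blast
qed

text \<open>
  In prime characteristic, the powers of the characteristic are such exponents.
\<close>

definition frobenius_power :: "'a::comm_ring_1 itself \<Rightarrow> nat \<Rightarrow> bool" where
  "frobenius_power _ Q \<longleftrightarrow> 0 < Q \<and> (\<forall>x y :: 'a. (x + y) ^ Q = x ^ Q + y ^ Q)"

lemma frobenius_sum:
  assumes "frobenius_power TYPE('a::comm_ring_1) Q"
  shows "(\<Sum>i\<in>A. f i :: 'a) ^ Q = (\<Sum>i\<in>A. f i ^ Q)"
  using assms unfolding frobenius_power_def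
  by (induction A rule: infinite_finite_induct) (auto simp: power_0_left)

text \<open>
  The \<open>Q\<close>-th powers of reduced data for \<open>y\<close> are reduced data for \<open>y\<^sup>Q\<close>: raising the Bezout identity to the
  \<open>Q\<close>-th power gives one for the powers. Hence every common denominator \<open>E\<close> of \<open>y\<^sup>Q\<close> is a multiple of \<open>D\<^sup>Q\<close>.
\<close>

lemma tuple_bound_frobenius:
  fixes y :: "'i \<Rightarrow> 'f::field poly fract"
  assumes I: "finite I" and Q: "frobenius_power TYPE('f poly) Q"
    and bound: "tuple_bound I (\<lambda>i. y i ^ Q) n"
  shows "tuple_bound I y (n div Q)"
proof -
  have Q0: "0 < Q" using Q by (simp add: frobenius_power_def)
  obtain E b where Eb: "E \<noteq> 0" "degree E \<le> n" "\<forall>i\<in>I. degree (b i) \<le> n"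
    "\<forall>i\<in>I. of_poly E * y i ^ Q = of_poly (b i)" using bound by (rule tuple_boundE)
  note Eb = Eb[rule_format]
  obtain D a u w where D: "D \<noteq> 0" "\<forall>i\<in>I. of_poly D * y i = of_poly (a i)"
    "w * D + (\<Sum>i\<in>I. u i * a i) = 1" by (rule reduced_common_denominator[OF I])
  note D = D[rule_format]
  have rel: "E * a i ^ Q = D ^ Q * b i" if "i \<in> I" for i
  proof -
    have "of_poly (E * a i ^ Q) = of_poly E * (of_poly D * y i) ^ Q"
      unfolding D(2)[OF that] by simp
    also have "\<dots> = of_poly D ^ Q * (of_poly E * y i ^ Q)"
      by (simp add: power_mult_distrib mult_ac)
    also have "\<dots> = of_poly (D ^ Q * b i)" unfolding Eb(4)[OF that] by simp
    finally show ?thesis unfolding of_poly_eq_iff .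
  qed
  have "1 = (w * D + (\<Sum>i\<in>I. u i * a i)) ^ Q" unfolding D(3) by simp
  also have "\<dots> = (w * D) ^ Q + (\<Sum>i\<in>I. (u i * a i) ^ Q)"
    using Q frobenius_sum[OF Q] by (simp add: frobenius_power_def)
  finally have "E * 1 = E * ((w * D) ^ Q + (\<Sum>i\<in>I. (u i * a i) ^ Q))" by simp
  also have "\<dots> = E * w ^ Q * D ^ Q + (\<Sum>i\<in>I. u i ^ Q * (E * a i ^ Q))"
    by (simp add: algebra_simps power_mult_distrib sum_distrib_left)
  also have "\<dots> = D ^ Q * (E * w ^ Q + (\<Sum>i\<in>I. u i ^ Q * b i))"
    using rel by (simp add: algebra_simps sum_distrib_left)
  finally obtain F where F: "E = D ^ Q * F" by simp
  have F0: "F \<noteq> 0" using F Eb(1) by auto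
  have b: "b i = a i ^ Q * F" if "i \<in> I" for i
  proof -
    have "D ^ Q * b i = E * a i ^ Q" using rel[OF that] by simp
    also have "\<dots> = D ^ Q * (a i ^ Q * F)" unfolding F by (simp only: mult_ac)
    finally have "D ^ Q * b i = D ^ Q * (a i ^ Q * F)" .
    moreover have "D ^ Q \<noteq> 0" using D(1) by simp
    ultimately show ?thesis using mult_left_cancel by blast
  qed
  have root: "degree p \<le> n div Q" if "degree (p ^ Q * F) \<le> n" for p
  proof (cases "p = 0")
    case False
    then have "Q * degree p \<le> n"
      using that F0 by (simp add: degree_mult_eq degree_power_eq)
    then show ?thesis using Q0 by (simp add: less_eq_div_iff_mult_less_eq mult.commute)
  qed simp
  show ?thesis
    using D(1,2) root Eb(2,3) F b by (intro tuple_boundI[of D _ _ a]) auto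
qed

definition tuple_height :: "'i set \<Rightarrow> ('i \<Rightarrow> 'f::field poly fract) \<Rightarrow> nat" where
  "tuple_height I y = (LEAST n. tuple_bound I y n)"

lemma tuple_height_le_iff:
  assumes "finite I"
  shows "tuple_height I y \<le> n \<longleftrightarrow> tuple_bound I y n"
proof
  have "tuple_bound I y (tuple_height I y)"
    unfolding tuple_height_def using tuple_bound_exists[OF assms] by (rule LeastI_ex)
  then show "tuple_height I y \<le> n \<Longrightarrow> tuple_bound I y n" using tuple_bound_mono by blast
qed (simp add: tuple_height_def Least_le)

section \<open>Frobenius-compatible coordinates on a finite extension\<close>

lemma frobenius_power_iterate:
  assumes "frobenius_power TYPE('a::comm_ring_1) Q"
  shows "frobenius_power TYPE('a) (Q ^ n)"
proof -
  have "(x + y) ^ Q ^ n = x ^ Q ^ n + y ^ Q ^ n" for x y :: 'a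
  proof (induction n)
    case (Suc n)
    have "(x + y) ^ Q ^ Suc n = ((x + y) ^ Q ^ n) ^ Q" by (simp add: power_mult[symmetric] mult.commute)
    also have "\<dots> = (x ^ Q ^ n) ^ Q + (y ^ Q ^ n) ^ Q"
      using assms unfolding Suc frobenius_power_def by blast
    also have "\<dots> = x ^ Q ^ Suc n + y ^ Q ^ Suc n" by (simp add: power_mult[symmetric] mult.commute)
    finally show ?case .
  qed simp
  then show ?thesis using assms by (simp add: frobenius_power_def)
qed

lemma unital_ring_hom_of_nat:
  assumes "unital_ring_hom h"
  shows "h (of_nat n) = of_nat n" "h 0 = 0"
proof -
  show 0: "h 0 = 0" using assms unfolding unital_ring_hom_def by (metis add_cancel_right_right)
  show "h (of_nat n) = of_nat n"
    using assms by (induction n) (auto simp: unital_ring_hom_def 0)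
qed

text \<open>
  The polynomial \<open>(X + 1)\<^sup>q - X\<^sup>q - 1\<close> has degree less than \<open>q\<close> and vanishes at all \<open>q\<close> elements of the
  field, so its coefficients are zero.
\<close>

lemma binomial_card_finite_field:
  assumes "0 < i" "i < CARD('fq::finite_field)"
  shows "of_nat (CARD('fq) choose i) = (0 :: 'fq)"
proof -
  let ?q = "CARD('fq)"
  define P :: "'fq poly" where "P = (\<Sum>i\<in>{0<..<?q}. monom (of_nat (?q choose i)) i)"
  have q0: "0 < ?q" by simp
  have root: "poly P x = 0" for x
  proof -
    have "x + 1 = (x + 1) ^ ?q" by (simp add: finite_field_power_card_eq_same)
    also have "\<dots> = (\<Sum>i\<le>?q. of_nat (?q choose i) * x ^ i)"
      by (simp add: binomial_ring)
    also have "{..?q} = insert 0 (insert ?q {0<..<?q})" by auto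
    also have "(\<Sum>i\<in>\<dots>. of_nat (?q choose i) * x ^ i) = 1 + (x ^ ?q + poly P x)"
      by (simp add: P_def poly_sum poly_monom)
    finally show ?thesis by (simp add: finite_field_power_card_eq_same)
  qed
  have "degree P \<le> ?q - 1"
    unfolding P_def by (intro degree_sum_le) (auto intro: order.trans[OF degree_monom_le])
  have "P = 0"
  proof (rule ccontr)
    assume "P \<noteq> 0"
    then have "card {x. poly P x = 0} \<le> degree P" by (rule card_poly_roots_bound)
    then show False using root \<open>degree P \<le> ?q - 1\<close> q0 by simp
  qed
  then have "coeff P i = 0" by simp
  then show ?thesis using assms by (simp add: P_def coeff_sum)
qed

lemma frobenius_power_card:
  assumes h: "unital_ring_hom (h :: 'fq::finite_field \<Rightarrow> 'a::comm_ring_1)"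
  shows "frobenius_power TYPE('a) CARD('fq)"
proof -
  let ?q = "CARD('fq)"
  have "(x + y) ^ ?q = x ^ ?q + y ^ ?q" for x y :: 'a
  proof -
    have "of_nat (?q choose i) = (0 :: 'a)" if "0 < i" "i < ?q" for i
      using binomial_card_finite_field[OF that] unital_ring_hom_of_nat[OF h] by metis
    then have "(\<Sum>i\<in>{0<..<?q}. of_nat (?q choose i) * x ^ i * y ^ (?q - i)) = 0"
      by (intro sum.neutral) auto
    moreover have "{..?q} = insert 0 (insert ?q {0<..<?q})" by auto
    ultimately show ?thesis by (simp add: binomial_ring)
  qed
  then show ?thesis by (simp add: frobenius_power_def)
qed

text \<open>
  The functionals are extended to the whole space because they will also be applied to vectors
  outside the span of \<open>S\<close>.
\<close>

lemma (in vector_space) dual_functionals: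
  assumes S: "finite S" "independent S"
  obtains \<kappa> where "\<forall>s x y. \<kappa> s (x + y) = \<kappa> s x + \<kappa> s y" "\<forall>s c x. \<kappa> s (scale c x) = c * \<kappa> s x"
    "\<forall>s\<in>S. \<forall>t\<in>S. \<kappa> s t = (if s = t then 1 else 0)"
    "\<forall>x\<in>span S. x = (\<Sum>s\<in>S. scale (\<kappa> s x) s)"
proof -
  let ?B = "extend_basis S"
  define \<kappa> where "\<kappa> s x = representation ?B x s" for s x
  have B: "independent ?B" "span ?B = UNIV" "S \<subseteq> ?B"
    using S independent_extend_basis extend_basis_superset by auto
  have add: "\<kappa> s (x + y) = \<kappa> s x + \<kappa> s y" for s x y
    unfolding \<kappa>_def by (subst representation_add) (use B in auto)
  have scale: "\<kappa> s (scale c x) = c * \<kappa> s x" for s c x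
    unfolding \<kappa>_def by (subst representation_scale) (use B in auto)
  have basis: "\<kappa> s t = (if s = t then 1 else 0)" if "s \<in> S" "t \<in> S" for s t
    unfolding \<kappa>_def using representation_basis[OF B(1), of t] that B(3) by auto
  have "x = (\<Sum>s\<in>S. scale (\<kappa> s x) s)" if x: "x \<in> span S" for x
  proof -
    obtain u where u: "x = (\<Sum>s\<in>S. scale (u s) s)" using x span_finite[OF S(1)] by auto
    have zero: "\<kappa> s 0 = 0" for s using scale[of s 0 0] by simp
    have "\<kappa> t x = u t" if t: "t \<in> S" for t
    proof -
      have "\<kappa> t (\<Sum>s\<in>T. scale (u s) s) = (\<Sum>s\<in>T. u s * \<kappa> t s)" for T
        by (induction T rule: infinite_finite_induct) (simp_all add: zero add scale)
      then have "\<kappa> t x = (\<Sum>s\<in>S. u s * (if t = s then 1 else 0))"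
        unfolding u using basis[OF t] by (auto intro!: sum.cong)
      also have "\<dots> = u t" using S t by (simp add: if_distrib cong: if_cong)
      finally show ?thesis .
    qed
    then show ?thesis by (subst u) (auto intro!: sum.cong)
  qed
  then show thesis using add scale basis by (intro that[of \<kappa>]) blast+
qed

text \<open>
  Consider the subspaces \<open>U\<^sub>n\<close> spanned by the \<open>Q\<^sup>n\<close>-th powers, and let \<open>E\<close> be a basis of one with the
  least dimension. The \<open>Q\<close>-th powers of \<open>E\<close> span \<open>U\<^bsub>N+1\<^esub>\<close>, so by minimality they are linearly independent.
  This is the separability that makes \<open>f e x ^ Q\<close> a linear function of the coordinates of \<open>x ^ Q\<close>, where
  \<open>f e x\<close> denotes the \<open>e\<close>-coordinate of \<open>x ^ (Q ^ N)\<close>.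
\<close>

lemma frobenius_coordinates:
  fixes h :: "'k::field \<Rightarrow> 'l::field"
  assumes h: "unital_ring_hom h" and B: "finite B" "Modules.module.span (\<lambda>c x. h c * x) B = UNIV"
    and Q: "frobenius_power TYPE('l) Q"
  obtains E :: "'l set" and f :: "'l \<Rightarrow> 'l \<Rightarrow> 'k" and N :: nat where
    "finite E" "\<forall>x. (\<forall>e\<in>E. f e x = 0) \<longrightarrow> x = 0"
    "\<forall>e x y. f e (x + y) = f e x + f e y"
    "\<forall>e c x. f e (h c * x) = c ^ (Q ^ N) * f e x"
    "\<forall>c. \<exists>A. \<forall>x. \<forall>e\<in>E. f e (c * x) = (\<Sum>e'\<in>E. A e e' * f e' x)"
    "\<exists>C. \<forall>x. \<forall>e\<in>E. f e x ^ Q = (\<Sum>e'\<in>E. C e e' * f e' (x ^ Q))"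
proof -
  have hom: "h (x + y) = h x + h y" "h (x * y) = h x * h y" "h 1 = 1" for x y
    using h by (auto simp: unital_ring_hom_def)
  have hpow: "h (x ^ n) = h x ^ n" for x n by (induction n) (simp_all add: hom)
  have h0: "h 0 = 0" using unital_ring_hom_of_nat[OF h] by simp
  interpret K: vector_space "\<lambda>c x. h c * x"
    by unfold_locales (simp_all add: hom algebra_simps)
  \<comment> \<open>It is enough that \<open>E\<close> spans a space containing \<open>U\<^sub>n\<close>.\<close>
  define ok where "ok = (\<lambda>(n, E). finite E \<and> K.independent E \<and> (\<forall>x. x ^ (Q ^ n) \<in> K.span E))"
  have "\<exists>z. ok z"
  proof -
    obtain E where "E \<subseteq> B" "K.independent E" "B \<subseteq> K.span E"
      using K.maximal_independent_subset[of B] by blast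
    moreover from this have "K.span E = UNIV"
      using B(2) K.span_mono[of B "K.span E"] by (auto simp: K.span_span)
    ultimately have "ok (0, E)" using B(1) finite_subset by (auto simp: ok_def)
    then show ?thesis ..
  qed
  then obtain z0 where z0: "ok z0" by blast
  obtain z where z: "ok z" "\<And>z'. ok z' \<Longrightarrow> card (snd z) \<le> card (snd z')"
    using arg_min_nat_lemma[of ok z0 "\<lambda>z. card (snd z)"] z0 by blast
  obtain N E where NE: "z = (N, E)" by (cases z)
  have E: "finite E" "K.independent E" "\<And>x. x ^ (Q ^ N) \<in> K.span E"
    using z(1) by (auto simp: NE ok_def)
  have min: "card E \<le> card G" if "ok (n, G)" for n G using z(2)[OF that] by (simp add: NE)
  obtain \<kappa> where \<kappa>: "\<forall>s x y. \<kappa> s (x + y) = \<kappa> s x + \<kappa> s y" "\<forall>s c x. \<kappa> s (h c * x) = c * \<kappa> s x"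
    "\<forall>s\<in>E. \<forall>t\<in>E. \<kappa> s t = (if s = t then 1 else 0)"
    "\<forall>x\<in>K.span E. x = (\<Sum>s\<in>E. h (\<kappa> s x) * s)"
    by (rule K.dual_functionals[OF E(1,2)])
  note \<kappa> = \<kappa>[rule_format]
  define f where "f e x = \<kappa> e (x ^ (Q ^ N))" for e x
  have expand: "x ^ (Q ^ N) = (\<Sum>e\<in>E. h (f e x) * e)" for x
    unfolding f_def by (rule \<kappa>(4)[OF E(3)])
  have expandQ: "x ^ (Q ^ Suc N) = (\<Sum>e\<in>E. h (f e x ^ Q) * e ^ Q)" for x
  proof -
    have "x ^ (Q ^ Suc N) = (x ^ (Q ^ N)) ^ Q" by (simp add: power_mult[symmetric] mult.commute)
    then show ?thesis
      by (simp add: expand frobenius_sum[OF Q] power_mult_distrib hpow)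
  qed
  let ?F = "(\<lambda>e. e ^ Q) ` E"
  obtain G where G: "G \<subseteq> ?F" "K.independent G" "?F \<subseteq> K.span G"
    using K.maximal_independent_subset[of ?F] by blast
  have "ok (Suc N, G)"
  proof -
    have "x ^ (Q ^ Suc N) \<in> K.span G" for x
      unfolding expandQ using G(3) by (intro K.span_sum K.span_scale) auto
    then show ?thesis using G E(1) finite_subset[OF G(1)] by (simp add: ok_def)
  qed
  then have cG: "card E \<le> card G" by (rule min)
  moreover have "card G \<le> card ?F" "card ?F \<le> card E"
    using G(1) E(1) by (auto intro: card_mono card_image_le)
  ultimately have GF: "G = ?F" and cF: "card ?F = card E"
    using card_subset_eq[OF _ G(1)] E(1) by auto
  have inj: "inj_on (\<lambda>e. e ^ Q) E" using eq_card_imp_inj_on[OF E(1) cF] .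
  obtain \<mu> where \<mu>: "\<forall>s x y. \<mu> s (x + y) = \<mu> s x + \<mu> s y" "\<forall>s c x. \<mu> s (h c * x) = c * \<mu> s x"
    "\<forall>s\<in>?F. \<forall>t\<in>?F. \<mu> s t = (if s = t then 1 else 0)"
    "\<forall>x\<in>K.span ?F. x = (\<Sum>s\<in>?F. h (\<mu> s x) * s)"
    by (rule K.dual_functionals[OF finite_imageI[OF E(1)] G(2)[unfolded GF]])
  note \<mu> = \<mu>[rule_format]
  have lin: "\<nu> (\<Sum>i\<in>I. h (c i) * w i) = (\<Sum>i\<in>I. c i * \<nu> (w i))"
    if "\<And>x y. \<nu> (x + y) = \<nu> x + \<nu> y" "\<And>c x. \<nu> (h c * x) = c * \<nu> x"
    for \<nu> :: "'l \<Rightarrow> 'k" and I :: "'l set" and c w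
  proof -
    have "\<nu> 0 = 0" using that(2)[of 0 0] by simp
    then show ?thesis by (induction I rule: infinite_finite_induct) (simp_all add: that)
  qed
  have add: "f e (x + y) = f e x + f e y" for e x y
    using frobenius_power_iterate[OF Q, of N] by (simp add: f_def frobenius_power_def \<kappa>)
  have scale: "f e (h c * x) = c ^ (Q ^ N) * f e x" for e c x
    by (simp add: f_def power_mult_distrib flip: hpow \<kappa>(2))
  have inj0: "x = 0" if "\<And>e. e \<in> E \<Longrightarrow> f e x = 0" for x
  proof -
    have "x ^ (Q ^ N) = 0" unfolding expand using that by (simp add: h0)
    then show ?thesis by simp
  qed
  have mult: "\<exists>A. \<forall>x. \<forall>e\<in>E. f e (c * x) = (\<Sum>e'\<in>E. A e e' * f e' x)" for c
  proof (intro exI allI ballI)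
    fix x e
    have "f e (c * x) = \<kappa> e (\<Sum>e'\<in>E. h (f e' x) * (c ^ (Q ^ N) * e'))"
      unfolding f_def[of e] power_mult_distrib expand[of x] by (simp add: sum_distrib_left mult_ac)
    also have "\<dots> = (\<Sum>e'\<in>E. f e' x * \<kappa> e (c ^ (Q ^ N) * e'))"
      by (rule lin[OF \<kappa>(1,2)])
    finally show "f e (c * x) = (\<Sum>e'\<in>E. \<kappa> e (c ^ (Q ^ N) * e') * f e' x)"
      by (simp only: mult.commute)
  qed
  have "\<exists>C. \<forall>x. \<forall>e\<in>E. f e x ^ Q = (\<Sum>e'\<in>E. C e e' * f e' (x ^ Q))"
  proof (intro exI allI ballI)
    fix x e assume e: "e \<in> E"
    have "\<mu> (e ^ Q) (x ^ (Q ^ Suc N)) = (\<Sum>e'\<in>E. f e' x ^ Q * \<mu> (e ^ Q) (e' ^ Q))"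
      unfolding expandQ by (rule lin[OF \<mu>(1,2)])
    also have "\<dots> = (\<Sum>e'\<in>E. f e' x ^ Q * (if e = e' then 1 else 0))"
      using e by (intro sum.cong refl) (auto simp: \<mu>(3) dest: inj_onD[OF inj])
    also have "\<dots> = f e x ^ Q" using e E(1) by (simp add: if_distrib cong: if_cong)
    finally have "f e x ^ Q = \<mu> (e ^ Q) ((x ^ Q) ^ (Q ^ N))"
      by (simp add: power_mult)
    also have "\<dots> = \<mu> (e ^ Q) (\<Sum>e'\<in>E. h (f e' (x ^ Q)) * e')" by (simp only: expand)
    also have "\<dots> = (\<Sum>e'\<in>E. f e' (x ^ Q) * \<mu> (e ^ Q) e')" by (rule lin[OF \<mu>(1,2)])
    finally show "f e x ^ Q = (\<Sum>e'\<in>E. \<mu> (e ^ Q) e' * f e' (x ^ Q))"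
      by (simp only: mult.commute)
  qed
  then show thesis using E(1) inj0 add scale mult by (intro that[of E f N]) blast+
qed

section \<open>Skew polynomials as operators\<close>

lemma skew_apply_atMost:
  assumes "degree f \<le> n"
  shows "skew_apply q f x = (\<Sum>i\<le>n. coeff f i * x ^ (q ^ i))"
  unfolding skew_apply_def
  by (rule sum.mono_neutral_left) (use assms in \<open>auto simp: coeff_eq_0\<close>)

lemma skew_apply_0 [simp]: "skew_apply q 0 x = 0"
  by (simp add: skew_apply_def)

lemma skew_apply_const [simp]: "skew_apply q [:c:] x = c * x"
  by (simp add: skew_apply_def)

lemma skew_apply_one [simp]: "skew_apply q 1 x = x"
  by (simp add: skew_apply_def)

lemma skew_apply_monom [simp]: "skew_apply q (monom c i) x = c * x ^ (q ^ i)"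
proof -
  have "skew_apply q (monom c i) x = (\<Sum>j\<le>i. coeff (monom c i) j * x ^ (q ^ j))"
    by (rule skew_apply_atMost) (rule degree_monom_le)
  also have "\<dots> = (\<Sum>j\<le>i. if i = j then c * x ^ (q ^ j) else 0)"
    by (intro sum.cong) auto
  finally show ?thesis by simp
qed

lemma skew_apply_add_left: "skew_apply q (f + g) x = skew_apply q f x + skew_apply q g x"
proof -
  let ?n = "max (degree f) (degree g)"
  have "skew_apply q (f + g) x = (\<Sum>i\<le>?n. coeff (f + g) i * x ^ (q ^ i))"
    by (rule skew_apply_atMost) (rule degree_add_le_max)
  then show ?thesis
    using skew_apply_atMost[of f ?n q x] skew_apply_atMost[of g ?n q x]
    by (simp add: algebra_simps sum.distrib)
qed

lemma skew_apply_sum_left: "skew_apply q (\<Sum>i\<in>A. f i) x = (\<Sum>i\<in>A. skew_apply q (f i) x)"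
  by (induction A rule: infinite_finite_induct) (simp_all add: skew_apply_add_left)

lemma skew_apply_add_right:
  assumes "frobenius_power TYPE('a::comm_ring_1) q"
  shows "skew_apply q f (x + y :: 'a) = skew_apply q f x + skew_apply q f y"
  using frobenius_power_iterate[OF assms]
  by (simp add: skew_apply_def frobenius_power_def algebra_simps sum.distrib)

lemma skew_apply_zero_right:
  assumes "frobenius_power TYPE('a::comm_ring_1) q"
  shows "skew_apply q f (0 :: 'a) = 0"
  using skew_apply_add_right[OF assms, of f 0 0] by simp

lemma skew_apply_sum_right:
  assumes "frobenius_power TYPE('a::comm_ring_1) q"
  shows "skew_apply q f (\<Sum>i\<in>A. y i :: 'a) = (\<Sum>i\<in>A. skew_apply q f (y i))"
  by (induction A rule: infinite_finite_induct)
    (simp_all add: skew_apply_add_right[OF assms] skew_apply_zero_right[OF assms])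

lemma skew_apply_skew_mult:
  assumes "frobenius_power TYPE('a::comm_ring_1) q"
  shows "skew_apply q (skew_mult q f g) (x :: 'a) = skew_apply q f (skew_apply q g x)"
proof -
  have "skew_apply q (skew_mult q f g) x
      = (\<Sum>i\<le>degree f. \<Sum>j\<le>degree g. coeff f i * coeff g j ^ (q ^ i) * x ^ (q ^ (i + j)))"
    by (simp add: skew_mult_def skew_apply_sum_left)
  also have "\<dots> = (\<Sum>i\<le>degree f. coeff f i * (\<Sum>j\<le>degree g. coeff g j * x ^ (q ^ j)) ^ (q ^ i))"
    by (intro sum.cong refl)
      (simp add: frobenius_sum[OF frobenius_power_iterate[OF assms]] sum_distrib_left
        power_mult_distrib power_add mult_ac flip: power_mult)
  finally show ?thesis by (simp only: skew_apply_def)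
qed

lemma smult_sum_distrib: "smult c (\<Sum>i\<in>A. p i) = (\<Sum>i\<in>A. smult c (p i))"
  by (induction A rule: infinite_finite_induct) (simp_all add: smult_add_right)

lemma skew_mult_atMost:
  assumes "degree f \<le> n"
  shows "skew_mult q f g = (\<Sum>i\<le>n. \<Sum>j\<le>degree g. monom (coeff f i * coeff g j ^ (q ^ i)) (i + j))"
  unfolding skew_mult_def
  by (rule sum.mono_neutral_left) (use assms in \<open>auto simp: coeff_eq_0\<close>)

lemma skew_mult_add_left: "skew_mult q (f + g) p = skew_mult q f p + skew_mult q g p"
proof -
  let ?n = "max (degree f) (degree g)"
  have "skew_mult q (f + g) p
      = (\<Sum>i\<le>?n. \<Sum>j\<le>degree p. monom (coeff (f + g) i * coeff p j ^ (q ^ i)) (i + j))"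
    by (rule skew_mult_atMost) (rule degree_add_le_max)
  then show ?thesis
    using skew_mult_atMost[of f ?n q p] skew_mult_atMost[of g ?n q p]
    by (simp add: algebra_simps sum.distrib flip: add_monom)
qed

lemma skew_mult_smult_left: "skew_mult q (smult c f) p = smult c (skew_mult q f p)"
proof -
  have "skew_mult q (smult c f) p
      = (\<Sum>i\<le>degree f. \<Sum>j\<le>degree p. monom (coeff (smult c f) i * coeff p j ^ (q ^ i)) (i + j))"
    by (rule skew_mult_atMost) (rule degree_smult_le)
  also have "\<dots> = smult c (skew_mult q f p)"
    by (simp add: skew_mult_def smult_sum_distrib smult_monom mult.assoc)
  finally show ?thesis .
qed

lemma skew_mult_const_left [simp]: "skew_mult q [:c:] p = smult c p"
proof -
  have "skew_mult q [:c:] p = (\<Sum>j\<le>degree p. smult c (monom (coeff p j) j))"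
    by (simp add: skew_mult_def smult_monom)
  then show ?thesis by (simp add: poly_as_sum_of_monoms flip: smult_sum_distrib)
qed

lemma skew_left_mult_const: "skew_left_mult q [:c:] m = (\<chi> j. smult c (m $ j))"
  by (simp add: skew_left_mult_def)

text \<open>
  Skew multiplication is composition of operators, so a ring homomorphism into skew matrices is an action.
\<close>

lemma skew_representation_module:
  fixes \<psi> :: "'fq::finite_field poly \<Rightarrow> 'a::field poly ^ 'n::finite ^ 'n"
  assumes frob: "frobenius_power TYPE('a) CARD('fq)"
    and add: "\<And>a b. \<psi> (a + b) = \<psi> a + \<psi> b"
    and mult: "\<And>a b. \<psi> (a * b) = skew_mat_mult CARD('fq) (\<psi> a) (\<psi> b)"
    and one: "\<psi> 1 = mat 1"
  shows "Modules.module (t_action \<psi>)"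
proof
  let ?q = "CARD('fq)"
  fix a b x y
  show "t_action \<psi> a (x + y) = t_action \<psi> a x + t_action \<psi> a y"
    by (simp add: t_action_def vec_eq_iff skew_apply_add_right[OF frob] sum.distrib)
  show "t_action \<psi> (a + b) x = t_action \<psi> a x + t_action \<psi> b x"
    by (simp add: t_action_def vec_eq_iff add skew_apply_add_left sum.distrib)
  have "(\<Sum>j\<in>UNIV. \<Sum>k\<in>UNIV. skew_apply ?q (\<psi> a $ i $ k) (skew_apply ?q (\<psi> b $ k $ j) (x $ j)))
      = (\<Sum>k\<in>UNIV. \<Sum>j\<in>UNIV. skew_apply ?q (\<psi> a $ i $ k) (skew_apply ?q (\<psi> b $ k $ j) (x $ j)))" for i
    by (rule sum.swap)
  then show "t_action \<psi> a (t_action \<psi> b x) = t_action \<psi> (a * b) x"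
    by (simp add: t_action_def vec_eq_iff mult skew_mat_mult_def skew_apply_sum_left
        skew_apply_skew_mult[OF frob] skew_apply_sum_right[OF frob])
  have "(\<Sum>j\<in>UNIV. skew_apply ?q (\<psi> 1 $ i $ j) (x $ j)) = (\<Sum>j\<in>UNIV. if i = j then x $ j else 0)" for i
    by (intro sum.cong) (auto simp: one mat_def)
  then show "t_action \<psi> 1 x = x"
    by (simp add: t_action_def vec_eq_iff)
qed

lemma map_poly_to_ac_add: "map_poly to_ac (f + g) = map_poly to_ac f + map_poly to_ac g"
  by (rule poly_eqI) (simp add: coeff_map_poly)

lemma map_poly_to_ac_sum: "map_poly to_ac (\<Sum>i\<in>A. f i) = (\<Sum>i\<in>A. map_poly to_ac (f i))"
  by (induction A rule: infinite_finite_induct) (simp_all add: map_poly_to_ac_add)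

lemma degree_map_poly_to_ac [simp]: "degree (map_poly to_ac f) = degree f"
  by (rule degree_map_poly) simp

lemma map_poly_to_ac_skew_mult:
  "map_poly to_ac (skew_mult q f g) = skew_mult q (map_poly to_ac f) (map_poly to_ac g)"
  by (simp add: skew_mult_def map_poly_to_ac_sum map_poly_monom coeff_map_poly)

lemma skew_apply_map_poly_to_ac:
  "skew_apply q (map_poly to_ac f) (to_ac x) = to_ac (skew_apply q f x)"
  by (simp add: skew_apply_def coeff_map_poly to_ac_sum)

lemma t_action_base_extension:
  fixes \<phi> :: "'fq::finite_field poly \<Rightarrow> 'k::field poly ^ 'n::finite ^ 'n"
  shows "t_action (base_extension \<phi>) a (\<chi> i. to_ac (x $ i)) = (\<chi> i. to_ac (t_action \<phi> a x $ i))"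
  by (simp add: t_action_def base_extension_def vec_eq_iff skew_apply_map_poly_to_ac to_ac_sum)

lemma base_extension_action_module:
  fixes \<phi> :: "'fq::finite_field poly \<Rightarrow> 'k::field poly ^ 'n::finite ^ 'n"
  assumes \<iota>: "unital_ring_hom (\<iota> :: 'fq \<Rightarrow> 'k)" and \<phi>: "t_module \<iota> \<theta> \<phi>"
  shows "Modules.module (t_action (base_extension \<phi>))"
proof (rule skew_representation_module)
  have "unital_ring_hom (\<lambda>c. to_ac (\<iota> c))"
    using \<iota> by (simp add: unital_ring_hom_def)
  then show "frobenius_power TYPE('k alg_closure) CARD('fq)"
    by (rule frobenius_power_card)
  show "base_extension \<phi> (a + b) = base_extension \<phi> a + base_extension \<phi> b" for a b
    using \<phi> by (simp add: t_module_def base_extension_def vec_eq_iff map_poly_to_ac_add)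
  show "base_extension \<phi> (a * b) = skew_mat_mult CARD('fq) (base_extension \<phi> a) (base_extension \<phi> b)" for a b
    using \<phi> by (simp add: t_module_def base_extension_def vec_eq_iff skew_mat_mult_def
        map_poly_to_ac_sum map_poly_to_ac_skew_mult)
  have "\<phi> [:1:] = mat [:\<iota> 1:]" using \<phi> unfolding t_module_def by blast
  then have "\<phi> 1 = mat 1" using \<iota> by (simp add: unital_ring_hom_def one_pCons)
  then show "base_extension \<phi> 1 = mat 1"
    by (simp add: base_extension_def vec_eq_iff mat_def)
qed

section \<open>Elements of the motive as functionals\<close>

lemma motive_scale_atMost:
  fixes \<phi> :: "'fq::finite_field poly \<Rightarrow> 'k::field poly ^ 'n::finite ^ 'n"
  assumes "degree f \<le> n"
  shows "motive_scale \<phi> f m = (\<Sum>i\<le>n. \<chi> j. smult (coeff f i)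
    (((\<lambda>x. skew_row_mult CARD('fq) x (\<phi> [:0, 1:])) ^^ i) m $ j))"
  unfolding motive_scale_def skew_left_mult_const
  by (rule sum.mono_neutral_left) (use assms in \<open>auto simp: coeff_eq_0 vec_eq_iff\<close>)

text \<open>
  All axioms follow from Horner's rule \<open>(a + t f) m = a m + t (f m)\<close> and the fact that \<open>t\<close> acts linearly
  over the constants.
\<close>

lemma motive_scale_module:
  fixes \<phi> :: "'fq::finite_field poly \<Rightarrow> 'k::field poly ^ 'n::finite ^ 'n"
  shows "Modules.module (motive_scale \<phi>)"
proof -
  define T where "T m = skew_row_mult CARD('fq) m (\<phi> [:0, 1:])" for m :: "'k poly ^ 'n"
  define S where "S c m = (\<chi> j. smult c (m $ j))" for c and m :: "'k poly ^ 'n"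
  have T_add: "T (m + m') = T m + T m'" for m m'
    by (simp add: T_def skew_row_mult_def vec_eq_iff skew_mult_add_left sum.distrib)
  have T_scale: "T (S c m) = S c (T m)" for c m
    by (simp add: T_def S_def skew_row_mult_def vec_eq_iff skew_mult_smult_left smult_sum_distrib)
  have T_0: "T 0 = 0" using T_add[of 0 0] by simp
  have T_sum: "T (\<Sum>i\<in>A. m i) = (\<Sum>i\<in>A. T (m i))" for m and A :: "nat set"
    by (induction A rule: infinite_finite_induct) (simp_all add: T_add T_0)
  have T_iter_add: "(T ^^ i) (m + m') = (T ^^ i) m + (T ^^ i) m'" for i m m'
    by (induction i) (simp_all add: T_add)
  have S_add: "S c (m + m') = S c m + S c m'" "S (c + c') m = S c m + S c' m" for c c' m m'
    by (simp_all add: S_def vec_eq_iff smult_add_right smult_add_left)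
  have S_0: "S 0 m = 0" "S 1 m = m" "S c (S c' m) = S (c * c') m" for c c' m
    by (simp_all add: S_def vec_eq_iff)
  have S_z: "S c 0 = 0" for c by (simp add: S_def vec_eq_iff)
  have S_sum: "S c (\<Sum>i\<in>A. m i) = (\<Sum>i\<in>A. S c (m i))" for m c and A :: "nat set"
    by (induction A rule: infinite_finite_induct) (simp_all add: S_add S_z)
  have scale: "motive_scale \<phi> f m = (\<Sum>i\<le>n. S (coeff f i) ((T ^^ i) m))" if "degree f \<le> n" for f m n
  proof -
    have "T = (\<lambda>x. skew_row_mult CARD('fq) x (\<phi> [:0, 1:]))" by (simp add: T_def fun_eq_iff)
    then show ?thesis using motive_scale_atMost[OF that, of \<phi> m] by (simp add: S_def)
  qed
  have add_right: "motive_scale \<phi> f (m + m') = motive_scale \<phi> f m + motive_scale \<phi> f m'" for f m m'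
    by (simp add: scale[OF order.refl] T_iter_add S_add sum.distrib)
  have add_left: "motive_scale \<phi> (f + g) m = motive_scale \<phi> f m + motive_scale \<phi> g m" for f g m
  proof -
    let ?n = "max (degree f) (degree g)"
    have "motive_scale \<phi> (f + g) m = (\<Sum>i\<le>?n. S (coeff (f + g) i) ((T ^^ i) m))"
      by (rule scale) (rule degree_add_le_max)
    then show ?thesis
      using scale[of f ?n m] scale[of g ?n m] by (simp add: S_add sum.distrib)
  qed
  have pCons: "motive_scale \<phi> (pCons a f) m = S a m + T (motive_scale \<phi> f m)" for a f m
  proof -
    have "motive_scale \<phi> (pCons a f) m
        = (\<Sum>i\<le>Suc (degree f). S (coeff (pCons a f) i) ((T ^^ i) m))"
      by (rule scale) (rule degree_pCons_le)
    also have "\<dots> = S a m + (\<Sum>i\<le>degree f. S (coeff f i) (T ((T ^^ i) m)))"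
      by (subst sum.atMost_Suc_shift) simp
    also have "(\<Sum>i\<le>degree f. S (coeff f i) (T ((T ^^ i) m))) = T (motive_scale \<phi> f m)"
      by (simp add: scale[OF order.refl] T_sum T_scale)
    finally show ?thesis .
  qed
  have zero: "motive_scale \<phi> 0 m = 0" for m by (simp add: scale[of 0 0] S_0)
  have smult: "motive_scale \<phi> (smult c f) m = S c (motive_scale \<phi> f m)" for c f m
    using scale[OF degree_smult_le, of c f m] by (simp add: scale[of f "degree f"] S_sum S_0)
  have mult: "motive_scale \<phi> (f * g) m = motive_scale \<phi> f (motive_scale \<phi> g m)" for f g m
    by (induction f) (simp_all add: zero mult_pCons_left add_left smult pCons S_0)
  show ?thesis
    by unfold_locales
      (simp_all add: add_right add_left mult one_pCons pCons zero S_0 T_0)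
qed

text \<open>
  The pairing of the motive with the points, under which left multiplication by skew polynomials acts on
  the value and \<open>t\<close> acts on the point.
\<close>

definition motive_eval :: "nat \<Rightarrow> 'a::comm_ring_1 poly ^ 'n::finite \<Rightarrow> 'a ^ 'n \<Rightarrow> 'a" where
  "motive_eval q m x = (\<Sum>j\<in>UNIV. skew_apply q (m $ j) (x $ j))"

lemma motive_eval_add_left: "motive_eval q (m + m') x = motive_eval q m x + motive_eval q m' x"
  by (simp add: motive_eval_def skew_apply_add_left sum.distrib)

lemma motive_eval_sum_left: "motive_eval q (\<Sum>i\<in>A. m i) x = (\<Sum>i\<in>A. motive_eval q (m i) x)"
proof -
  have "motive_eval q 0 x = 0" by (simp add: motive_eval_def)
  then show ?thesis
    by (induction A rule: infinite_finite_induct) (simp_all add: motive_eval_add_left)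
qed

lemma motive_eval_diff_right:
  assumes "frobenius_power TYPE('a::comm_ring_1) q"
  shows "motive_eval q m (x - y :: 'a ^ 'n::finite) = motive_eval q m x - motive_eval q m y"
proof -
  have "motive_eval q m (x - y) + motive_eval q m y = motive_eval q m ((x - y) + y)"
    unfolding motive_eval_def
    by (simp add: skew_apply_add_right[OF assms, symmetric] sum.distrib[symmetric])
  then show ?thesis by (simp add: eq_diff_eq)
qed

lemma motive_eval_skew_left_mult:
  assumes "frobenius_power TYPE('a::comm_ring_1) q"
  shows "motive_eval q (skew_left_mult q f m) (x :: 'a ^ 'n::finite) = skew_apply q f (motive_eval q m x)"
  by (simp add: motive_eval_def skew_left_mult_def skew_apply_skew_mult[OF assms]
      skew_apply_sum_right[OF assms])

lemma motive_eval_row_mult: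
  fixes \<phi> :: "'fq::finite_field poly \<Rightarrow> 'k::field poly ^ 'n::finite ^ 'n"
  assumes "frobenius_power TYPE('k) CARD('fq)"
  shows "motive_eval CARD('fq) (skew_row_mult CARD('fq) m (\<phi> a)) x
    = motive_eval CARD('fq) m (t_action \<phi> a x)"
proof -
  let ?q = "CARD('fq)"
  have "motive_eval ?q (skew_row_mult ?q m (\<phi> a)) x
      = (\<Sum>j\<in>UNIV. \<Sum>i\<in>UNIV. skew_apply ?q (m $ i) (skew_apply ?q (\<phi> a $ i $ j) (x $ j)))"
    by (simp add: motive_eval_def skew_row_mult_def skew_apply_sum_left skew_apply_skew_mult[OF assms])
  also have "\<dots> = (\<Sum>i\<in>UNIV. \<Sum>j\<in>UNIV. skew_apply ?q (m $ i) (skew_apply ?q (\<phi> a $ i $ j) (x $ j)))"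
    by (rule sum.swap)
  finally show ?thesis
    by (simp add: motive_eval_def t_action_def skew_apply_sum_right[OF assms])
qed

lemma motive_eval_iterate:
  fixes \<phi> :: "'fq::finite_field poly \<Rightarrow> 'k::field poly ^ 'n::finite ^ 'n"
  assumes frob: "frobenius_power TYPE('k) CARD('fq)" and mod: "Modules.module (t_action \<phi>)"
  shows "motive_eval CARD('fq) (((\<lambda>x. skew_row_mult CARD('fq) x (\<phi> [:0, 1:])) ^^ i) m) x
    = motive_eval CARD('fq) m (t_action \<phi> (monom 1 i) x)"
proof (induction i arbitrary: x)
  case 0
  then show ?case using module.scale_one[OF mod] by simp
next
  case (Suc i)
  have "monom 1 i * [:0, 1:] = (monom 1 (Suc i) :: 'fq poly)"
    by (simp add: monom_Suc)
  then show ?case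
    using Suc module.scale_scale[OF mod] by (simp add: motive_eval_row_mult[OF frob])
qed

lemma motive_eval_scale:
  fixes \<phi> :: "'fq::finite_field poly \<Rightarrow> 'k::field poly ^ 'n::finite ^ 'n"
  assumes frob: "frobenius_power TYPE('k) CARD('fq)" and mod: "Modules.module (t_action \<phi>)"
    and n: "degree f \<le> n"
  shows "motive_eval CARD('fq) (motive_scale \<phi> f m) x
    = (\<Sum>i\<le>n. coeff f i * motive_eval CARD('fq) m (t_action \<phi> (monom 1 i) x))"
proof -
  have smult: "(\<chi> j. smult c (v $ j)) = skew_left_mult CARD('fq) [:c:] v" for c and v :: "'k poly ^ 'n"
    by (simp add: skew_left_mult_const)
  show ?thesis
    unfolding motive_scale_atMost[OF n] motive_eval_sum_left smult
    by (simp add: motive_eval_skew_left_mult[OF frob] motive_eval_iterate[OF frob mod])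
qed

text \<open>
  Finite generation of the motive over \<open>K[t]\<close>, in terms of functionals. A single bound \<open>w\<close> for the degrees
  in \<open>t\<close> is available since only finitely many elements are expanded at a time.
\<close>

lemma abelian_motive_expansion:
  fixes \<phi> :: "'fq::finite_field poly \<Rightarrow> 'k::field poly ^ 'n::finite ^ 'n"
  assumes frob: "frobenius_power TYPE('k) CARD('fq)" and mod: "Modules.module (t_action \<phi>)"
    and ab: "abelian_t_module \<phi>"
  obtains B where "finite B" "\<forall>M. finite M \<longrightarrow> (\<exists>w c. \<forall>m\<in>M. \<forall>x. motive_eval CARD('fq) m x
    = (\<Sum>b\<in>B. \<Sum>i\<le>w. c m b i * motive_eval CARD('fq) b (t_action \<phi> (monom 1 i) x)))"
proof -
  interpret M: Modules.module "motive_scale \<phi>" by (rule motive_scale_module)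
  obtain B where B: "finite B" "M.span B = UNIV" using ab unfolding abelian_t_module_def by blast
  have "\<forall>m. \<exists>u. m = (\<Sum>b\<in>B. motive_scale \<phi> (u b) b)"
    using B(2) unfolding M.span_finite[OF B(1)] by blast
  then obtain u where u: "\<And>m. m = (\<Sum>b\<in>B. motive_scale \<phi> (u m b) b)" by metis
  have "\<exists>w c. \<forall>m\<in>M. \<forall>x. motive_eval CARD('fq) m x
    = (\<Sum>b\<in>B. \<Sum>i\<le>w. c m b i * motive_eval CARD('fq) b (t_action \<phi> (monom 1 i) x))"
    if M: "finite M" for M
  proof -
    define w where "w = (\<Sum>(m, b)\<in>M \<times> B. degree (u m b))"
    have w: "degree (u m b) \<le> w" if "m \<in> M" "b \<in> B" for m b
      using member_le_sum[of "(m, b)" "M \<times> B" "\<lambda>(m, b). degree (u m b)"] that M B(1)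
      by (auto simp: w_def)
    have "motive_eval CARD('fq) m x
      = (\<Sum>b\<in>B. \<Sum>i\<le>w. coeff (u m b) i * motive_eval CARD('fq) b (t_action \<phi> (monom 1 i) x))"
      if m: "m \<in> M" for m x
    proof -
      have "motive_eval CARD('fq) m x = (\<Sum>b\<in>B. motive_eval CARD('fq) (motive_scale \<phi> (u m b) b) x)"
        by (subst u[of m]) (rule motive_eval_sum_left)
      also have "\<dots> = (\<Sum>b\<in>B. \<Sum>i\<le>w. coeff (u m b) i * motive_eval CARD('fq) b (t_action \<phi> (monom 1 i) x))"
        by (intro sum.cong refl motive_eval_scale[OF frob mod] w m)
      finally show ?thesis .
    qed
    then show ?thesis by (intro exI[of _ w] exI[of _ "\<lambda>m b. coeff (u m b)"]) blast
  qed
  then show thesis using that B(1) by blast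
qed

lemma t_module_action_module:
  fixes \<phi> :: "'fq::finite_field poly \<Rightarrow> 'k::field poly ^ 'n::finite ^ 'n"
  assumes \<iota>: "unital_ring_hom (\<iota> :: 'fq \<Rightarrow> 'k)" and \<phi>: "t_module \<iota> \<theta> \<phi>"
  shows "Modules.module (t_action \<phi>)"
proof (rule skew_representation_module)
  show "frobenius_power TYPE('k) CARD('fq)" by (rule frobenius_power_card[OF \<iota>])
  show "\<phi> (a + b) = \<phi> a + \<phi> b" "\<phi> (a * b) = skew_mat_mult CARD('fq) (\<phi> a) (\<phi> b)" for a b
    using \<phi> unfolding t_module_def by blast+
  have "\<phi> [:1:] = mat [:\<iota> 1:]" using \<phi> unfolding t_module_def by blast
  then show "\<phi> 1 = mat 1" using \<iota> by (simp add: unital_ring_hom_def one_pCons)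
qed

lemma motive_eval_axis: "motive_eval q (axis i [:1:]) x = x $ i"
proof -
  have "motive_eval q (axis i [:1:]) x = (\<Sum>j\<in>UNIV. if j = i then x $ j else 0)"
    unfolding motive_eval_def by (intro sum.cong) (auto simp: axis_def)
  then show ?thesis by simp
qed

lemma motive_eval_axis_right:
  fixes x :: "'a::comm_ring_1" and m :: "'a poly ^ 'n::finite"
  assumes "frobenius_power TYPE('a) q"
  shows "motive_eval q m (axis i x) = skew_apply q (m $ i) x"
proof -
  have "motive_eval q m (axis i x) = (\<Sum>j\<in>UNIV. if j = i then skew_apply q (m $ j) x else 0)"
    unfolding motive_eval_def by (intro sum.cong) (auto simp: axis_def skew_apply_zero_right[OF assms])
  then show ?thesis by simp
qed

section \<open>The height on the points of an abelian t-module\<close>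

text \<open>
  The entries of the tuple attached to \<open>x\<close> are \<open>g (e, b, k) x\<close>, the \<open>e\<close>-coordinate over \<open>\<bbbF>\<^sub>q(x)\<close> of the value of
  the generator \<open>b\<close> at \<open>t\<^sup>k x\<close>, with \<open>k < d\<close>. The number \<open>d\<close> exceeds the degrees in \<open>t\<close> that are needed to
  write the \<open>\<tau>\<^sup>2 b\<close> and the coordinate functions in terms of the generators.
\<close>

lemma t_module_height:
  fixes \<iota> :: "'fq::finite_field \<Rightarrow> 'k::field"
    and \<phi> :: "'fq poly \<Rightarrow> 'k poly ^ 'n::finite ^ 'n"
  assumes K: "global_function_field \<iota>" and tm: "t_module \<iota> \<theta> \<phi>" and ab: "abelian_t_module \<phi>"
  obtains H :: "'k ^ 'n \<Rightarrow> nat" and d c e s where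
    "\<forall>x y. H (x - y) \<le> H x + H y" "\<forall>n. finite {x. H x \<le> n}"
    "\<forall>x. 2 * H x \<le> H (t_action \<phi> (monom 1 d) x) + c"
    "\<forall>n. 2 ^ n \<le> card {x. H x \<le> e * n + s}"
proof -
  let ?q = "CARD('fq)"
  \<comment> \<open>With \<open>q\<close> itself the expansion factor would be \<open>q - 1\<close>, which is too small for \<open>q = 2\<close>.\<close>
  define Q where "Q = ?q ^ 2"
  obtain h :: "'fq poly fract \<Rightarrow> 'k" and B0 where \<iota>: "unital_ring_hom \<iota>" and h: "unital_ring_hom h"
    and B0: "finite B0" "Modules.module.span (\<lambda>c x. h c * x) B0 = UNIV"
    using K unfolding global_function_field_def by blast
  have frob: "frobenius_power TYPE('k) ?q" by (rule frobenius_power_card[OF \<iota>])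
  have frobQ: "frobenius_power TYPE('k) Q" unfolding Q_def by (rule frobenius_power_iterate[OF frob])
  have "unital_ring_hom (\<lambda>c :: 'fq. [:c:])" by (simp add: unital_ring_hom_def)
  then have "frobenius_power TYPE('fq poly) ?q" by (rule frobenius_power_card)
  then have frobP: "frobenius_power TYPE('fq poly) Q" unfolding Q_def by (rule frobenius_power_iterate)
  have "card {0, 1 :: 'fq} \<le> ?q" by (rule card_mono) auto
  then have "2 \<le> ?q" by simp
  then have "2 * 2 \<le> ?q * ?q" by (rule mult_le_mono) fact
  then have Q4: "4 \<le> Q" by (simp add: Q_def power2_eq_square)
  have mod: "Modules.module (t_action \<phi>)" by (rule t_module_action_module[OF \<iota> tm])
  interpret M: Modules.module "t_action \<phi>" by (rule mod)
  define T where "T i = t_action \<phi> (monom 1 i)" for i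
  have T_add: "T i (T j x) = T (i + j) x" for i j x by (simp add: T_def mult_monom)
  define ev where "ev b x = motive_eval ?q b x" for b :: "'k poly ^ 'n" and x
  have ev_diff: "ev b (x - y) = ev b x - ev b y" for b x y
    unfolding ev_def by (rule motive_eval_diff_right[OF frob])
  obtain B where B: "finite B" and expansion: "\<forall>M. finite M \<longrightarrow> (\<exists>w c. \<forall>m\<in>M. \<forall>x. ev m x
    = (\<Sum>b\<in>B. \<Sum>i\<le>w. c m b i * ev b (T i x)))"
    unfolding ev_def T_def by (rule abelian_motive_expansion[OF frob mod ab])
  define Fr where "Fr b = skew_left_mult ?q (monom 1 2) b" for b :: "'k poly ^ 'n"
  have ev_Fr: "ev (Fr b) x = ev b x ^ Q" for b x
    unfolding ev_def Fr_def by (simp add: motive_eval_skew_left_mult[OF frob] Q_def)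
  have "finite (Fr ` B \<union> range (\<lambda>i. axis i [:1:]))" using B by simp
  then obtain w c where wc: "\<And>m x. m \<in> Fr ` B \<union> range (\<lambda>i. axis i [:1:]) \<Longrightarrow>
      ev m x = (\<Sum>b\<in>B. \<Sum>i\<le>w. c m b i * ev b (T i x))"
    using expansion by meson
  define d where "d = Suc w"
  obtain E :: "'k set" and f :: "'k \<Rightarrow> 'k \<Rightarrow> 'fq poly fract" and N :: nat where E: "finite E"
    and f_inj: "\<forall>x. (\<forall>e\<in>E. f e x = 0) \<longrightarrow> x = 0"
    and f_add: "\<forall>e x y. f e (x + y) = f e x + f e y"
    and f_scale: "\<forall>e c x. f e (h c * x) = c ^ (Q ^ N) * f e x"
    and f_mult: "\<forall>c. \<exists>A. \<forall>x. \<forall>e\<in>E. f e (c * x) = (\<Sum>e'\<in>E. A e e' * f e' x)"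
    and f_frob: "\<exists>C. \<forall>x. \<forall>e\<in>E. f e x ^ Q = (\<Sum>e'\<in>E. C e e' * f e' (x ^ Q))"
    by (rule frobenius_coordinates[OF h B0 frobQ])
  have f_0: "f e 0 = 0" for e
    using f_scale[rule_format, of e 0 0] Q4 by (simp add: power_0_left)
  have f_sum: "f e (\<Sum>i\<in>A. y i) = (\<Sum>i\<in>A. f e (y i))" for e and A :: "'z set" and y
    by (induction A rule: infinite_finite_induct) (simp_all add: f_0 f_add)
  have f_diff: "f e (x - y) = f e x - f e y" for e x y
    using f_add[rule_format, of e "x - y" y] by simp
  define g where "g = (\<lambda>(e, b, k) x. f e (ev b (T k x)))"
  define I where "I n = E \<times> B \<times> {..<n}" for n :: nat
  have finI: "finite (I n)" for n by (simp add: I_def E B)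
  have g_diff: "g r (x - y) = g r x - g r y" for r x y
    by (cases r) (simp add: g_def T_def M.scale_right_diff_distrib ev_diff f_diff)
  have g_inj: "x = y" if "\<And>r. r \<in> I d \<Longrightarrow> g r x = g r y" for x y
  proof -
    have "ev b (T k (x - y)) = 0" if "b \<in> B" "k \<le> w" for b k
    proof -
      have "f e (ev b (T k (x - y))) = 0" if "e \<in> E" for e
        using \<open>\<And>r. r \<in> I d \<Longrightarrow> g r x = g r y\<close>[of "(e, b, k)"] g_diff[of "(e, b, k)" x y]
          that \<open>b \<in> B\<close> \<open>k \<le> w\<close>
        by (simp add: I_def g_def d_def)
      then show ?thesis using f_inj by blast
    qed
    then have "(x - y) $ i = 0" for i
      using wc[of "axis i [:1:]" "x - y"] by (simp add: ev_def motive_eval_axis)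
    then show "x = y" by (simp add: vec_eq_iff)
  qed
  define H where "H x = tuple_height (I d) (\<lambda>r. g r x)" for x
  have H_le: "H x \<le> n \<longleftrightarrow> tuple_bound (I d) (\<lambda>r. g r x) n" for x n
    unfolding H_def by (rule tuple_height_le_iff[OF finI])
  have diff: "H (x - y) \<le> H x + H y" for x y
    unfolding H_le g_diff by (rule tuple_bound_diff) (simp_all flip: H_le)
  have north: "finite {x. H x \<le> n}" for n
  proof -
    have "finite {x \<in> UNIV. tuple_bound (I d) (\<lambda>r. g r x) n}"
      by (rule tuple_bound_finite[OF finI]) (rule g_inj)
    then show ?thesis by (simp add: H_le)
  qed
  \<comment> \<open>\<open>comb F\<close>: \<open>F x\<close> is a fixed linear combination of the entries for \<open>x\<close> and for \<open>t\<^sup>d x\<close>.\<close>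
  define comb where "comb F \<longleftrightarrow> (\<exists>C. \<forall>x. F x = (\<Sum>r\<in>I (2 * d). C r * g r x))" for F
  have comb_g: "comb (g r)" if "r \<in> I (2 * d)" for r
  proof -
    have "g r x = (\<Sum>s\<in>I (2 * d). (if s = r then 1 else 0) * g s x)" for x
      using that finI by (simp add: if_distrib[of "\<lambda>z. z * _"] cong: if_cong)
    then show ?thesis unfolding comb_def by (intro exI allI)
  qed
  have comb_scale: "comb (\<lambda>x. a * F x)" if F: "comb F" for a F
  proof -
    obtain C where C: "\<forall>x. F x = (\<Sum>r\<in>I (2 * d). C r * g r x)" using F unfolding comb_def by blast
    have "a * F x = (\<Sum>r\<in>I (2 * d). (a * C r) * g r x)" for x
      using C by (simp add: sum_distrib_left mult.assoc)
    then show ?thesis unfolding comb_def by (intro exI allI)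
  qed
  have comb_add: "comb (\<lambda>x. F x + G x)" if F: "comb F" and G: "comb G" for F G
  proof -
    obtain C where C: "\<forall>x. F x = (\<Sum>r\<in>I (2 * d). C r * g r x)" using F unfolding comb_def by blast
    obtain D where D: "\<forall>x. G x = (\<Sum>r\<in>I (2 * d). D r * g r x)" using G unfolding comb_def by blast
    have "F x + G x = (\<Sum>r\<in>I (2 * d). (C r + D r) * g r x)" for x
      using C D by (simp add: sum.distrib algebra_simps)
    then show ?thesis unfolding comb_def by (intro exI allI)
  qed
  have comb_sum: "comb (\<lambda>x. \<Sum>i\<in>A. F i x)" if "finite A" "\<And>i. i \<in> A \<Longrightarrow> comb (F i)"
    for A :: "'z set" and F
    using that
  proof (induction A rule: finite_induct)
    case empty
    then show ?case unfolding comb_def by (intro exI[of _ "\<lambda>_. 0"]) simp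
  qed (simp add: comb_add)
  have comb_f: "comb (\<lambda>x. f e (a * ev b (T k x)))" if e: "e \<in> E" "b \<in> B" "k < 2 * d" for e a b k
  proof -
    obtain A where A: "\<forall>x. \<forall>e\<in>E. f e (a * x) = (\<Sum>e'\<in>E. A e e' * f e' x)" using f_mult by blast
    have "f e (a * ev b (T k x)) = (\<Sum>e'\<in>E. A e e' * g (e', b, k) x)" for x
      using A e by (simp add: g_def)
    moreover have "comb (\<lambda>x. \<Sum>e'\<in>E. A e e' * g (e', b, k) x)"
      using e by (intro comb_sum E comb_scale comb_g) (simp add: I_def)
    ultimately show ?thesis by simp
  qed
  have comb_power: "comb (\<lambda>x. g r x ^ Q)" if r: "r \<in> I d" for r
  proof -
    obtain e b k where ebk: "r = (e, b, k)" by (cases r)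
    have e: "e \<in> E" "b \<in> B" "k \<le> w" using r by (auto simp: ebk I_def d_def)
    obtain C where C: "\<forall>x. \<forall>e\<in>E. f e x ^ Q = (\<Sum>e'\<in>E. C e e' * f e' (x ^ Q))" using f_frob by blast
    have "g r x ^ Q = (\<Sum>e'\<in>E. C e e' * (\<Sum>b'\<in>B. \<Sum>i\<le>w. f e' (c (Fr b) b' i * ev b' (T (i + k) x))))" for x
    proof -
      have "ev b (T k x) ^ Q = (\<Sum>b'\<in>B. \<Sum>i\<le>w. c (Fr b) b' i * ev b' (T (i + k) x))"
        using wc[of "Fr b" "T k x"] e by (simp add: ev_Fr T_add)
      then show ?thesis using C e(1) by (simp add: ebk g_def f_sum)
    qed
    moreover have "comb (\<lambda>x. \<Sum>e'\<in>E. C e e' * (\<Sum>b'\<in>B. \<Sum>i\<le>w. f e' (c (Fr b) b' i * ev b' (T (i + k) x))))"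
      using e by (intro comb_sum comb_scale comb_f E B) (auto simp: d_def)
    ultimately show ?thesis by simp
  qed
  then have "\<forall>r\<in>I d. \<exists>C. \<forall>x. g r x ^ Q = (\<Sum>s\<in>I (2 * d). C s * g s x)"
    unfolding comb_def ..
  then obtain C where C: "\<forall>r\<in>I d. \<forall>x. g r x ^ Q = (\<Sum>s\<in>I (2 * d). C r s * g s x)"
    by (rule bchoice[THEN exE])
  obtain c' where c': "\<forall>y n. tuple_bound (I (2 * d)) y n \<longrightarrow>
      tuple_bound (I d) (\<lambda>r. \<Sum>s\<in>I (2 * d). C r s * y s) (n + c')"
    using tuple_bound_linear[OF finI finI, of "2 * d" d C] by (rule exE)
  have expand: "2 * H x \<le> H (t_action \<phi> (monom 1 d) x) + c'" for x
  proof -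
    define shift where "shift = (\<lambda>(e :: 'k, b :: 'k poly ^ 'n, k). (e, b, k + d))"
    have shift: "g (shift r) x = g r (T d x)" for r
      by (cases r) (simp add: shift_def g_def T_add)
    \<comment> \<open>The entries with \<open>d \<le> k < 2 d\<close> are the entries for \<open>t\<^sup>d x\<close>.\<close>
    have I2: "I (2 * d) \<subseteq> I d \<union> shift ` I d"
    proof
      fix r assume r: "r \<in> I (2 * d)"
      obtain e b k where ebk: "r = (e, b, k)" by (cases r)
      show "r \<in> I d \<union> shift ` I d"
      proof (cases "k < d")
        case True
        then show ?thesis using r by (simp add: ebk I_def)
      next
        case False
        then have "r = shift (e, b, k - d)" "(e, b, k - d) \<in> I d"
          using r by (auto simp: ebk I_def shift_def)
        then show ?thesis by blast
      qed
    qed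
    have "tuple_bound (I d) (\<lambda>r. g r x) (H x)" by (simp flip: H_le)
    moreover have "tuple_bound (I d) (\<lambda>r. g (shift r) x) (H (T d x))"
      unfolding shift by (simp flip: H_le)
    then have "tuple_bound (shift ` I d) (\<lambda>r. g r x) (H (T d x))"
      by (rule tuple_bound_reindex[where y = "\<lambda>r. g r x", THEN iffD1])
    ultimately have "tuple_bound (I (2 * d)) (\<lambda>r. g r x) (H x + H (T d x))"
      using tuple_bound_subset[OF tuple_bound_Un I2] by blast
    then have "tuple_bound (I d) (\<lambda>r. \<Sum>s\<in>I (2 * d). C r s * g s x) (H x + H (T d x) + c')"
      using c' by blast
    then have "tuple_bound (I d) (\<lambda>r. g r x ^ Q) (H x + H (T d x) + c')"
      unfolding tuple_bound_def using C by simp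
    then have "H x \<le> (H x + H (T d x) + c') div Q"
      unfolding H_le by (rule tuple_bound_frobenius[OF finI frobP])
    then have "H x * Q \<le> H x + H (T d x) + c'"
      using Q4 by (simp add: less_eq_div_iff_mult_less_eq)
    moreover have "H x * 4 \<le> H x * Q" using Q4 by (rule mult_le_mono2)
    ultimately show ?thesis unfolding T_def by linarith
  qed
  \<comment> \<open>The points supported on one arbitrary coordinate with a polynomial entry \<open>p\<close>
    have height linear in \<open>degree p\<close>.\<close>
  define i0 :: 'n where "i0 = undefined"
  define pt where "pt p = axis i0 (h (of_poly p))" for p
  \<comment> \<open>The value of \<open>b\<close> at \<open>t\<^sup>k\<close> times such a point is a skew polynomial \<open>mo b k\<close> in
    its entry, so \<open>g r (pt p)\<close> is a polynomial in \<open>p\<close> with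
    coefficients \<open>cf (r, l)\<close>.\<close>
  define mo where "mo b k = (((\<lambda>x. skew_row_mult ?q x (\<phi> [:0, 1:])) ^^ k) b) $ i0" for b k
  define L where "L = (\<Sum>(e, b, k)\<in>I d. degree (mo b k))"
  define cf where "cf = (\<lambda>((e, b, k), l). f e (coeff (mo b k) l))"
  have hom: "h (x * y) = h x * h y" "h 1 = 1" for x y
    using h by (auto simp: unital_ring_hom_def)
  have hpow: "h (x ^ n) = h x ^ n" for x n by (induction n) (simp_all add: hom)
  have g_pt: "g r (pt p) = (\<Sum>l\<le>L. of_poly (p ^ (?q ^ l * Q ^ N)) * cf (r, l))" if r: "r \<in> I d" for r p
  proof -
    obtain e b k where ebk: "r = (e, b, k)" by (cases r)
    have "degree (mo b k) \<le> L"
      using member_le_sum[of r "I d" "\<lambda>(e, b, k). degree (mo b k)"] r finI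
      by (simp add: L_def ebk)
    then have "ev b (T k (pt p)) = (\<Sum>l\<le>L. coeff (mo b k) l * h (of_poly p) ^ (?q ^ l))"
      unfolding ev_def T_def motive_eval_iterate[OF frob mod, symmetric] pt_def
        motive_eval_axis_right[OF frob] mo_def[symmetric]
      by (rule skew_apply_atMost)
    also have "\<dots> = (\<Sum>l\<le>L. h (of_poly (p ^ (?q ^ l))) * coeff (mo b k) l)"
      by (simp add: hpow mult.commute)
    finally have "g r (pt p) = (\<Sum>l\<le>L. f e (h (of_poly (p ^ (?q ^ l))) * coeff (mo b k) l))"
      by (simp add: ebk g_def f_sum)
    also have "\<dots> = (\<Sum>l\<le>L. of_poly (p ^ (?q ^ l * Q ^ N)) * cf (r, l))"
      unfolding f_scale[rule_format] by (simp add: cf_def ebk power_mult)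
    finally show ?thesis .
  qed
  obtain s where "tuple_bound (I d \<times> {..L}) cf s"
    using tuple_bound_exists[of "I d \<times> {..L}" cf] finI by auto
  then obtain D a where D: "D \<noteq> 0" "degree D \<le> s" "\<forall>r\<in>I d \<times> {..L}. degree (a r) \<le> s"
    "\<forall>r\<in>I d \<times> {..L}. of_poly D * cf r = of_poly (a r)" by (rule tuple_boundE)
  define e where "e = ?q ^ L * Q ^ N"
  have H_pt: "H (pt p) \<le> e * n + s" if p: "degree p \<le> n" for p n
    unfolding H_le
  proof (rule tuple_boundI)
    show "D \<noteq> 0" "degree D \<le> e * n + s" using D by auto
    fix r assume r: "r \<in> I d"
    have "degree (p ^ (?q ^ l * Q ^ N) * a (r, l)) \<le> e * n + s" if "l \<le> L" for l
    proof (rule degree_mult_le_add)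
      have "degree (p ^ (?q ^ l * Q ^ N)) \<le> degree p * (?q ^ l * Q ^ N)"
        by (rule degree_power_le)
      also have "\<dots> \<le> n * e"
        unfolding e_def using p that Q4 by (intro mult_le_mono power_increasing) auto
      finally show "degree (p ^ (?q ^ l * Q ^ N)) \<le> e * n" by (simp add: mult.commute)
      show "degree (a (r, l)) \<le> s" using D r that by auto
    qed
    then show "degree (\<Sum>l\<le>L. p ^ (?q ^ l * Q ^ N) * a (r, l)) \<le> e * n + s"
      by (intro degree_sum_le) auto
    have "of_poly D * g r (pt p) = (\<Sum>l\<le>L. of_poly (p ^ (?q ^ l * Q ^ N)) * (of_poly D * cf (r, l)))"
      unfolding g_pt[OF r] sum_distrib_left by (simp add: mult.left_commute)
    also have "\<dots> = of_poly (\<Sum>l\<le>L. p ^ (?q ^ l * Q ^ N) * a (r, l))"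
      using D r by (simp add: of_poly_sum)
    finally show "of_poly D * g r (pt p) = of_poly (\<Sum>l\<le>L. p ^ (?q ^ l * Q ^ N) * a (r, l))" .
  qed
  have inj_pt: "inj pt"
  proof (rule injI)
    fix p r assume "pt p = pt r"
    then have "pt p $ i0 = pt r $ i0" by simp
    then have "h (of_poly p) = h (of_poly r)" by (simp add: pt_def axis_def)
    moreover have "inj h"
    proof (rule injI)
      fix x y assume xy: "h x = h y"
      have "h ((x - y) + y) = h (x - y) + h y" using h unfolding unital_ring_hom_def by blast
      then have "h (x - y) = 0" using xy by simp
      moreover have "h z \<noteq> 0" if "z \<noteq> 0" for z
        using hom(1)[of z "inverse z"] hom(2) that by auto
      ultimately have "x - y = 0" by blast
      then show "x = y" by simp
    qed
    ultimately show "p = r" by (simp add: inj_eq)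
  qed
  have plenty: "2 ^ n \<le> card {x. H x \<le> e * n + s}" for n
  proof -
    have "pt ` {p. degree p \<le> n} \<subseteq> {x. H x \<le> e * n + s}" using H_pt by blast
    then have "card (pt ` {p. degree p \<le> n}) \<le> card {x. H x \<le> e * n + s}"
      by (rule card_mono[OF north])
    then show ?thesis
      using card_poly_degree_le[of n, where 'f = 'fq] by (simp add: card_image inj_on_subset[OF inj_pt])
  qed
  show thesis using that[of H d c' e s] diff north expand plenty by blast
qed

section \<open>The Mordell--Weil theorem\<close>

lemma finite_extension_base: "finite_extension (range to_ac :: 'k::field alg_closure set)"
proof -
  interpret V: vector_space "\<lambda>c x. to_ac (c :: 'k) * x"
    by unfold_locales (simp_all add: algebra_simps)
  interpret R: Ring.field "ring_of_type_algebra :: 'k alg_closure ring" by (rule field_from_type_algebra)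
  have "subfield (range to_ac) (ring_of_type_algebra :: 'k alg_closure ring)"
  proof (rule R.subfieldI')
    show "subring (range to_ac) (ring_of_type_algebra :: 'k alg_closure ring)"
    proof (rule R.subringI)
      fix x y :: "'k alg_closure" assume "x \<in> range to_ac" "y \<in> range to_ac"
      then show "x \<oplus>\<^bsub>ring_of_type_algebra\<^esub> y \<in> range to_ac" "x \<otimes>\<^bsub>ring_of_type_algebra\<^esub> y \<in> range to_ac"
        by (auto simp: ring_of_type_algebra_def simp flip: to_ac_add to_ac_mult)
      have "\<ominus>\<^bsub>ring_of_type_algebra\<^esub> x = - x"
        by (rule R.minus_equality) (simp_all add: ring_of_type_algebra_def)
      then show "\<ominus>\<^bsub>ring_of_type_algebra\<^esub> x \<in> range to_ac"
        using \<open>x \<in> range to_ac\<close> by (auto simp flip: to_ac_minus)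
    qed (auto simp: ring_of_type_algebra_def intro: range_eqI[of _ _ 1])
    fix x :: "'k alg_closure" assume x: "x \<in> range to_ac - {\<zero>\<^bsub>ring_of_type_algebra\<^esub>}"
    have "inv\<^bsub>ring_of_type_algebra\<^esub> x = inverse x"
      by (rule R.comm_inv_char) (use x in \<open>auto simp: ring_of_type_algebra_def\<close>)
    then show "inv\<^bsub>ring_of_type_algebra\<^esub> x \<in> range to_ac"
      using x by (auto simp flip: to_ac_inverse)
  qed
  moreover have "V.span {1} = range to_ac" by (simp add: V.span_singleton)
  ultimately show ?thesis unfolding finite_extension_def by (auto intro!: exI[of _ "{1}"])
qed

theorem theorem4:
  fixes \<iota> :: "'fq::finite_field \<Rightarrow> 'k::field"
    and \<theta> :: 'k
    and \<phi> :: "'fq poly \<Rightarrow> 'k poly ^ 'n::finite ^ 'n"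
  assumes "global_function_field \<iota>"
    and "t_module \<iota> \<theta> \<phi>"
    and "pure_t_module \<phi>"
  shows "\<exists>L :: 'k alg_closure set.
           finite_extension L \<and> poonen_mordell_weil (t_action (base_extension \<phi>)) (points L)"
proof -
  let ?act = "t_action (base_extension \<phi>)"
  have \<iota>: "unital_ring_hom \<iota>" using assms(1) by (simp add: global_function_field_def)
  have "abelian_t_module \<phi>" using assms(3) by (simp add: pure_t_module_def)
  then obtain H d c e s where H: "\<forall>x y. H (x - y) \<le> H x + H y" "\<forall>n. finite {x. H x \<le> n}"
    "\<forall>x. 2 * H x \<le> H (t_action \<phi> (monom 1 d) x) + c"
    "\<forall>n. 2 ^ n \<le> card {x :: 'k ^ 'n. H x \<le> e * n + s}"
    by (rule t_module_height[OF assms(1,2)])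
  define up :: "'k ^ 'n \<Rightarrow> 'k alg_closure ^ 'n" where "up x = (\<chi> i. to_ac (x $ i))" for x
  define down :: "'k alg_closure ^ 'n \<Rightarrow> 'k ^ 'n" where "down x = (\<chi> i. of_ac (x $ i))" for x
  have down_up: "down (up x) = x" for x by (simp add: down_def up_def vec_eq_iff)
  have up_diff: "up (x - y) = up x - up y" for x y by (simp add: up_def vec_eq_iff)
  have up_add: "up (x + y) = up x + up y" for x y by (simp add: up_def vec_eq_iff)
  have up_act: "?act a (up x) = up (t_action \<phi> a x)" for a x
    unfolding up_def by (rule t_action_base_extension)
  have pts: "points (range to_ac) = range up"
  proof -
    have "x \<in> range up" if "x \<in> points (range to_ac)" for x
    proof -
      have "up (down x) = x"
        using that by (simp add: points_def up_def down_def vec_eq_iff to_ac_of_ac)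
      then show ?thesis by (metis rangeI)
    qed
    then show ?thesis by (auto simp: points_def up_def)
  qed
  have inj: "inj up" by (rule injI) (metis down_up)
  have bounded: "{x \<in> range up. H (down x) \<le> n} = up ` {x. H x \<le> n}" for n
    by (auto simp: down_up)
  interpret A: Modules.module ?act by (rule base_extension_action_module[OF \<iota> assms(2)])
  interpret A: plentiful_height_module ?act "range up" "\<lambda>x. H (down x)" d c e s
  proof unfold_locales
    have "up 0 = 0" by (simp add: up_def vec_eq_iff)
    then show "A.subspace (range up)"
      unfolding A.subspace_def by (auto simp: up_act simp flip: up_add intro: rev_image_eqI)
    show "H (down (x - y)) \<le> H (down x) + H (down y)" if "x \<in> range up" "y \<in> range up" for x y
      using that H(1) by (auto simp: down_up simp flip: up_diff)
    show "finite {x \<in> range up. H (down x) \<le> n}" for n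
      unfolding bounded using H(2) by blast
    show "2 * H (down x) \<le> H (down (?act (monom 1 d) x)) + c" if "x \<in> range up" for x
      using that H(3) by (auto simp: down_up up_act)
    show "2 ^ n \<le> card {x \<in> range up. H (down x) \<le> e * n + s}" for n
      unfolding bounded using H(4) by (simp add: card_image inj_on_subset[OF inj])
  qed
  show ?thesis
    using finite_extension_base A.poonen_mordell_weil_if_plentiful unfolding pts[symmetric] by blast
qed

end
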